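(* Let $\mathbf H$ be a finite connected ordered hypergraph that is right-filled. Then for any two constructs $S,T$ of $\mathbf H$, one has $S\leq T$ in the generalised flip order if and only if $$\mathrm{Inv}_{\mathbf H}(S)\subseteq\mathrm{Inv}_{\mathbf H}(T)\quad\text{and}\quad \widetilde{\mathrm{Inv}}_{\mathbf H}(S)\subseteq\widetilde{\mathrm{Inv}}_{\mathbf H}(T)\cup\mathrm{Inv}_{\mathbf H}(T).$$
   Context: A (finite) hypergraph $\mathbf H$ with finite vertex set $H$ is a set of non-empty subsets of $H$ (hyperedges) with $\bigcup\mathbf H=H$ and $\{x\}\in\mathbf H$ for all $x\in H$. For $X\subseteq H$, $\mathbf H_X:=\{Z\in\mathbf H: Z\subseteq X\}$ and $\mathbf H\setminus X:=\mathbf H_{H\setminus X}$. $\mathbf H$ is connected if there is no partition $H=X_1\cup X_2$ into two non-empty parts with $\mathbf H=\mathbf H_{X_1}\cup\mathbf H_{X_2}$. Every hypergraph is uniquely the union of its connected components; $\mathbf H,X\leadsto H_1,\dots,H_n$ means that $\mathbf H_{H_1},\dots,\mathbf H_{H_n}$ are the connected components of $\mathbf H\setminus X$. Constructs of a connected hypergraph $\mathbf H$ are non-planar rooted trees with nodes labelled by non-empty subsets of $H$, defined recursively: the one-node tree labelled $H$ is a construct of $\mathbf H$; if $\emptyset\neq Y\subsetneq H$, $\mathbf H,Y\leadsto H_1,\dots,H_n$, and $T_i$ is a construct of $\mathbf H_{H_i}$ for each $i$, then the tree $Y(T_1,\dots,T_n)$ with root $Y$ and immediate subtrees $T_1,\dots,T_n$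 is a construct of $\mathbf H$. Nodes are identified with their labels (the labels partition $H$). $\mathbf H$ is ordered if $H$ carries a total order; for non-empty $Y,Z\subseteq H$, $Y<Z$ (or $Z>Y$) means $\max Y<\min Z$. An ordered $\mathbf H$ is right-filled if for all $a,b,c\in H$ with $a<b<c$ and every hyperedge $X\in\mathbf H$ with $a,c\in X$, there is a hyperedge $Y\in\mathbf H$ with $\{b,c\}\subseteq Y\subseteq(X\setminus\{a\})\cup\{b\}$. If in a construct $S$ the node $X$ is the parent of the node $Y$, contracting the edge between them and labelling the merged node $X\cup Y$ yields a construct $T$; write $S\subset_{X,Y}T$. For constructs $S,S'$ of $\mathbf H$, $S\lessdot S'$ iff there exist $U,V$ with $U>V$ such that either $S\subset_{U,V}S'$ (fusion) or $S'\subset_{V,U}S$ (split). The generalised flip order $\leq$ is the reflexive and transitive closure of $\lessdot$. For a construct $S$ of $\mathbf H$ and $a,b\in H$ lying in the nodes $A,B$ of $S$ respectively: $b<_Sa$ iff $A\neq B$ and the path from $B$ to the root of $S$ passes through $A$ (i.e. $A$ is a proper ancestor of $B$); $a=_Sb$ iff $A=B$. Set $\mathrm{Inv}_{\mathbf H}(S)=\{(a,b)\in H\times H: a<b,\ b<_Sa\}$ and $\widetilde{\mathrm{Inv}}_{\mathbf H}(S)=\{(a,b)\in H\times H: a<b,\ a=_Sb\}$. *)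

theory Defs
  imports Main "HOL-Library.Multiset" "HOL-Library.Disjoint_Sets"
begin

section \<open>Hypergraphs\<close>

text \<open>A hypergraph is given by its set of hyperedges; its vertex set is their union.\<close>

abbreviation vertices :: "'a set set \<Rightarrow> 'a set" where
  "vertices E \<equiv> \<Union>E"

definition hypergraph :: "'a set set \<Rightarrow> bool" where
  "hypergraph E \<longleftrightarrow> finite (vertices E) \<and> {} \<notin> E \<and> (\<forall>x\<in>vertices E. {x} \<in> E)"

definition restr :: "'a set set \<Rightarrow> 'a set \<Rightarrow> 'a set set" where
  "restr E X = {Z \<in> E. Z \<subseteq> X}"

definition remove :: "'a set set \<Rightarrow> 'a set \<Rightarrow> 'a set set" where
  "remove E X = restr E (vertices E - X)"

definition hconnected :: "'a set set \<Rightarrow> bool" where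
  "hconnected E \<longleftrightarrow>
     \<not> (\<exists>X\<^sub>1 X\<^sub>2. X\<^sub>1 \<noteq> {} \<and> X\<^sub>2 \<noteq> {} \<and> X\<^sub>1 \<inter> X\<^sub>2 = {} \<and> X\<^sub>1 \<union> X\<^sub>2 = vertices E
          \<and> E = restr E X\<^sub>1 \<union> restr E X\<^sub>2)"

text \<open>\<open>conn_components E P\<close>: the hypergraph \<open>E\<close> is the disjoint union of the connected hypergraphs
  \<open>restr E C\<close>, for \<open>C \<in> P\<close>. A hypergraph has exactly one such decomposition \<open>P\<close>.\<close>

definition conn_components :: "'a set set \<Rightarrow> 'a set set \<Rightarrow> bool" where
  "conn_components E P \<longleftrightarrow> finite P \<and> partition_on (vertices E) P
     \<and> (\<forall>C\<in>P. hconnected (restr E C)) \<and> E = (\<Union>C\<in>P. restr E C)"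

definition right_filled :: "'a::linorder set set \<Rightarrow> bool" where
  "right_filled E \<longleftrightarrow>
     (\<forall>a\<in>vertices E. \<forall>b\<in>vertices E. \<forall>c\<in>vertices E. a < b \<longrightarrow> b < c \<longrightarrow>
        (\<forall>X\<in>E. a \<in> X \<longrightarrow> c \<in> X \<longrightarrow>
           (\<exists>Y\<in>E. {b, c} \<subseteq> Y \<and> Y \<subseteq> (X - {a}) \<union> {b})))"

section \<open>Constructs\<close>

text \<open>Non-planar rooted trees: the immediate subtrees of a node form a multiset.\<close>

datatype 'a ctree = Node "'a set" "'a ctree multiset"

primrec nodes :: "'a ctree \<Rightarrow> 'a set set" where
  "nodes (Node X ts) = insert X (\<Union> (set_mset (image_mset nodes ts)))"

inductive construct :: "'a set set \<Rightarrow> 'a ctree \<Rightarrow> bool" where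
  one_node: "vertices E \<noteq> {} \<Longrightarrow> construct E (Node (vertices E) {#})"
| graft: "Y \<noteq> {} \<Longrightarrow> Y \<subset> vertices E \<Longrightarrow> conn_components (remove E Y) P
    \<Longrightarrow> (\<And>C. C \<in> P \<Longrightarrow> construct (restr E C) (t C))
    \<Longrightarrow> construct E (Node Y (image_mset t (mset_set P)))"

text \<open>\<open>parent S X Y\<close>: in \<open>S\<close>, a node labelled \<open>X\<close> is the parent of a node labelled \<open>Y\<close>.
  In a construct the labels are pairwise disjoint, so nodes are identified with their labels.\<close>

inductive parent :: "'a ctree \<Rightarrow> 'a set \<Rightarrow> 'a set \<Rightarrow> bool" where
  root: "Node Y us \<in># ts \<Longrightarrow> parent (Node X ts) X Y"
| sub: "t \<in># ts \<Longrightarrow> parent t X Y \<Longrightarrow> parent (Node Z ts) X Y"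

text \<open>\<open>contracts S X Y T\<close>: contracting in \<open>S\<close> the edge between the node \<open>X\<close> and its child
  \<open>Y\<close> gives \<open>T\<close>.\<close>

inductive contracts :: "'a ctree \<Rightarrow> 'a set \<Rightarrow> 'a set \<Rightarrow> 'a ctree \<Rightarrow> bool" where
  root: "contracts (Node X (add_mset (Node Y us) ts)) X Y (Node (X \<union> Y) (us + ts))"
| sub: "contracts s X Y s'
    \<Longrightarrow> contracts (Node Z (add_mset s ts)) X Y (Node Z (add_mset s' ts))"

section \<open>The generalised flip order\<close>

text \<open>Only meant for finite non-empty sets.\<close>

definition set_less :: "'a::linorder set \<Rightarrow> 'a set \<Rightarrow> bool" where
  "set_less Y Z \<longleftrightarrow> Max Y < Min Z"

definition flip :: "'a::linorder set set \<Rightarrow> 'a ctree \<Rightarrow> 'a ctree \<Rightarrow> bool" where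
  "flip E S S' \<longleftrightarrow> construct E S \<and> construct E S' \<and>
     (\<exists>U V. set_less V U \<and> (contracts S U V S' \<or> contracts S' V U S))"

definition flip_le :: "'a::linorder set set \<Rightarrow> 'a ctree \<Rightarrow> 'a ctree \<Rightarrow> bool" where
  "flip_le E = (flip E)\<^sup>*\<^sup>*"

section \<open>Inversions\<close>

text \<open>\<open>below S b a\<close> is the relation written $b <_S a$: the node of \<open>a\<close> is a proper ancestor of
  the node of \<open>b\<close>.\<close>

definition below :: "'a ctree \<Rightarrow> 'a \<Rightarrow> 'a \<Rightarrow> bool" where
  "below S b a \<longleftrightarrow>
     (\<exists>A\<in>nodes S. \<exists>B\<in>nodes S. a \<in> A \<and> b \<in> B \<and> A \<noteq> B \<and> (parent S)\<^sup>*\<^sup>* A B)"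

definition same_node :: "'a ctree \<Rightarrow> 'a \<Rightarrow> 'a \<Rightarrow> bool" where
  "same_node S a b \<longleftrightarrow> (\<exists>A\<in>nodes S. a \<in> A \<and> b \<in> A)"

definition Inv :: "'a::linorder set set \<Rightarrow> 'a ctree \<Rightarrow> ('a \<times> 'a) set" where
  "Inv E S = {(a, b) \<in> vertices E \<times> vertices E. a < b \<and> below S b a}"

definition weak_Inv :: "'a::linorder set set \<Rightarrow> 'a ctree \<Rightarrow> ('a \<times> 'a) set" where
  "weak_Inv E S = {(a, b) \<in> vertices E \<times> vertices E. a < b \<and> same_node S a b}"

end

theory Submission
  imports Defs
begin

text \<open>
  A construct is encoded by the preorder \<open>wbelow S b a\<close>: the node of \<open>a\<close> is an ancestor of, or equal to,
  the node of \<open>b\<close>. Two facts about it carry the argument: every connected set of vertices has a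
  greatest element, and in a right-filled hypergraph the part of a connected set \<open>D\<close> lying above a vertex \<open>x\<close>, together
  with \<open>x\<close>, is connected as soon as \<open>D\<close> has an element \<open>\<le> x\<close>. Hence any node can be split along any cut
  of its label, and if \<open>w < x < u\<close> with \<open>u\<close> weakly below \<open>w\<close>, then \<open>x\<close> and \<open>w\<close> are comparable.

  Given \<open>S \<noteq> T\<close> satisfying the inversion condition, it suffices to find a flip of \<open>S\<close> that preserves
  the condition. If \<open>T\<close> separates two elements of a node of \<open>S\<close>, then \<open>T\<close> prescribes a split of that
  node. Otherwise there are \<open>w < u\<close> with \<open>w\<close> strictly below \<open>u\<close> in \<open>S\<close> and \<open>u\<close> weakly below \<open>w\<close> in
  \<open>T\<close>. Choosing the node of \<open>u\<close> as low as possible in \<open>S\<close>, then \<open>w\<close> as high as possible in \<open>T\<close>, with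
  ties broken by the largest \<open>w\<close>, the two nodes are adjacent in \<open>S\<close> and may be fused.
\<close>

subsection \<open>Connectivity\<close>

text \<open>The empty set counts as connected.\<close>

definition conn :: "'a set set \<Rightarrow> 'a set \<Rightarrow> bool" where
  "conn E D \<longleftrightarrow> (\<forall>A\<subseteq>D. A \<noteq> {} \<longrightarrow> A \<noteq> D \<longrightarrow> (\<exists>Z\<in>E. Z \<subseteq> D \<and> Z \<inter> A \<noteq> {} \<and> \<not> Z \<subseteq> A))"

text \<open>The development keeps one ambient \<open>E\<close> and varies the vertex set, so this
  stands in for \<open>conn_components (restr E D) P\<close>. The last conjunct is the decomposition
  equation read edge by edge.\<close>

definition comps :: "'a set set \<Rightarrow> 'a set \<Rightarrow> 'a set set \<Rightarrow> bool" where
  "comps E D P \<longleftrightarrow> finite P \<and> partition_on D P \<and> (\<forall>C\<in>P. conn E C)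
     \<and> (\<forall>Z\<in>E. Z \<subseteq> D \<longrightarrow> (\<exists>C\<in>P. Z \<subseteq> C))"

lemma conn_edge: "Z \<in> E \<Longrightarrow> conn E Z"
  unfolding conn_def by blast

lemma connE:
  assumes "conn E D" "A \<subseteq> D" "A \<noteq> {}" "A \<noteq> D"
  obtains Z where "Z \<in> E" "Z \<subseteq> D" "Z \<inter> A \<noteq> {}" "\<not> Z \<subseteq> A"
  using assms unfolding conn_def by blast

text \<open>A proper non-empty part \<open>A\<close> of the union cuts some member properly: if
  \<open>A\<close> contains the common point \<open>x\<close>, a member with a point outside
  \<open>A\<close>; otherwise a member with a point inside \<open>A\<close>.\<close>

lemma conn_Union:
  assumes "\<And>C. C \<in> \<C> \<Longrightarrow> conn E C \<and> x \<in> C"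
  shows "conn E (\<Union>\<C>)"
proof -
  have "\<exists>Z\<in>E. Z \<subseteq> \<Union>\<C> \<and> Z \<inter> A \<noteq> {} \<and> \<not> Z \<subseteq> A" if A: "A \<subseteq> \<Union>\<C>" "A \<noteq> {}" "A \<noteq> \<Union>\<C>" for A
  proof -
    obtain C where C: "C \<in> \<C>" "A \<inter> C \<noteq> {}" "A \<inter> C \<noteq> C"
    proof (cases "x \<in> A")
      case True
      then obtain y C where "C \<in> \<C>" "y \<in> C" "y \<notin> A" using A by blast
      then show thesis using that assms True by blast
    next
      case False
      obtain y C where "C \<in> \<C>" "y \<in> C" "y \<in> A" using A by blast
      then show thesis using that assms False by blast
    qed
    obtain Z where Z: "Z \<in> E" "Z \<subseteq> C" "Z \<inter> (A \<inter> C) \<noteq> {}" "\<not> Z \<subseteq> A \<inter> C"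
      using connE[of E C "A \<inter> C"] assms[OF C(1)] C by auto
    then show ?thesis using C(1) by blast
  qed
  then show ?thesis unfolding conn_def by blast
qed

lemma conn_Un: "conn E C \<Longrightarrow> conn E D \<Longrightarrow> x \<in> C \<Longrightarrow> x \<in> D \<Longrightarrow> conn E (C \<union> D)"
  using conn_Union[of "{C, D}" E x] by auto

lemma comps_Union: "comps E D P \<Longrightarrow> \<Union>P = D"
  by (simp add: comps_def partition_on_def)

lemma comps_disjoint: "comps E D P \<Longrightarrow> C \<in> P \<Longrightarrow> C' \<in> P \<Longrightarrow> x \<in> C \<Longrightarrow> x \<in> C' \<Longrightarrow> C = C'"
  unfolding comps_def partition_on_def disjoint_def by blast

text \<open>An edge of \<open>K\<close> leaving the block \<open>C\<close> would lie in a single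
  block; that block meets \<open>C\<close>, hence equals \<open>C\<close>, a contradiction.\<close>

lemma comps_conn:
  assumes "comps E D P" "conn E K" "K \<subseteq> D" "K \<noteq> {}"
  shows "\<exists>C\<in>P. K \<subseteq> C"
proof -
  have p: "partition_on D P" using assms(1) by (simp add: comps_def)
  obtain x where "x \<in> K" using assms by auto
  then obtain C where C: "C \<in> P" "x \<in> C"
    using p assms(3) partition_onD1 by blast
  have "K \<subseteq> C"
  proof (rule ccontr)
    assume "\<not> K \<subseteq> C"
    then obtain Z where Z: "Z \<in> E" "Z \<subseteq> K" "Z \<inter> (K \<inter> C) \<noteq> {}" "\<not> Z \<subseteq> K \<inter> C"
      using connE[OF assms(2), of "K \<inter> C"] \<open>x \<in> K\<close> C by auto
    then obtain C' where "C' \<in> P" "Z \<subseteq> C'" using assms(1,3) unfolding comps_def by (meson order_trans)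
    with Z C have "C' = C" using comps_disjoint[OF assms(1)] by blast
    with Z \<open>Z \<subseteq> C'\<close> show False by blast
  qed
  with C show ?thesis by blast
qed

text \<open>Blocks are connected, so each lies in a block of the other decomposition, which in turn
  lies in a block of the first. Disjointness makes all three equal.\<close>

lemma comps_unique:
  assumes "comps E D P" "comps E D Q"
  shows "P = Q"
proof -
  have "P \<subseteq> Q" if PQ: "comps E D P" "comps E D Q" for P Q
  proof
    fix C assume C: "C \<in> P"
    have pP: "partition_on D P" and pQ: "partition_on D Q"
      using PQ by (auto simp: comps_def)
    have sub: "C \<subseteq> D" "C \<noteq> {}" "conn E C"
      using C PQ pP by (auto simp: comps_def partition_on_def)
    then obtain C' where C': "C' \<in> Q" "C \<subseteq> C'" using comps_conn[OF PQ(2)] by blast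
    then have "C' \<subseteq> D" "C' \<noteq> {}" "conn E C'"
      using PQ pQ by (auto simp: comps_def partition_on_def)
    then obtain C'' where C'': "C'' \<in> P" "C' \<subseteq> C''" using comps_conn[OF PQ(1)] by blast
    then have "C'' = C" using C C' sub comps_disjoint[OF PQ(1)] by blast
    with C' C'' show "C \<in> Q" by auto
  qed
  with assms show ?thesis by blast
qed

section \<open>Restricted hypergraphs as vertex subsets of a fixed hypergraph\<close>

lemma restr_restr [simp]: "C \<subseteq> D \<Longrightarrow> restr (restr E D) C = restr E C"
  unfolding restr_def by auto

lemma restr_vertices [simp]: "restr E (\<Union>E) = E"
  unfolding restr_def by auto

lemma vertices_restr: "hypergraph E \<Longrightarrow> D \<subseteq> vertices E \<Longrightarrow> vertices (restr E D) = D"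
  unfolding hypergraph_def restr_def by blast

lemma hconnected_restr_iff:
  assumes "hypergraph E" "D \<subseteq> vertices E"
  shows "hconnected (restr E D) \<longleftrightarrow> conn E D"
proof
  assume h: "hconnected (restr E D)"
  show "conn E D"
    unfolding conn_def
  proof (intro allI impI)
    fix A assume A: "A \<subseteq> D" "A \<noteq> {}" "A \<noteq> D"
    show "\<exists>Z\<in>E. Z \<subseteq> D \<and> Z \<inter> A \<noteq> {} \<and> \<not> Z \<subseteq> A"
    proof (rule ccontr)
      assume *: "\<not> ?thesis"
      then have "restr E D = restr (restr E D) A \<union> restr (restr E D) (D - A)"
        using A unfolding restr_def by auto
      moreover have "A \<union> (D - A) = vertices (restr E D)" "A \<inter> (D - A) = {}" "D - A \<noteq> {}"
        using A by (auto simp: vertices_restr[OF assms])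
      ultimately have "\<exists>X\<^sub>1 X\<^sub>2. X\<^sub>1 \<noteq> {} \<and> X\<^sub>2 \<noteq> {} \<and> X\<^sub>1 \<inter> X\<^sub>2 = {}
          \<and> X\<^sub>1 \<union> X\<^sub>2 = vertices (restr E D) \<and> restr E D = restr (restr E D) X\<^sub>1 \<union> restr (restr E D) X\<^sub>2"
        using A(2) by (intro exI[of _ A] exI[of _ "D - A"]) simp
      then show False using h unfolding hconnected_def by (rule notE[rotated])
    qed
  qed
next
  assume c: "conn E D"
  show "hconnected (restr E D)"
    unfolding hconnected_def
  proof
    assume "\<exists>X\<^sub>1 X\<^sub>2. X\<^sub>1 \<noteq> {} \<and> X\<^sub>2 \<noteq> {} \<and> X\<^sub>1 \<inter> X\<^sub>2 = {} \<and> X\<^sub>1 \<union> X\<^sub>2 = vertices (restr E D)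
          \<and> restr E D = restr (restr E D) X\<^sub>1 \<union> restr (restr E D) X\<^sub>2"
    then obtain X Y where XY: "X \<noteq> {}" "Y \<noteq> {}" "X \<inter> Y = {}" "X \<union> Y = D"
      "restr E D = restr (restr E D) X \<union> restr (restr E D) Y"
      unfolding vertices_restr[OF assms] by (elim exE conjE)
    have "X \<subseteq> D" "X \<noteq> D" using XY(2-4) by auto
    then obtain Z where Z: "Z \<in> E" "Z \<subseteq> D" "Z \<inter> X \<noteq> {}" "\<not> Z \<subseteq> X"
      using connE[OF c _ XY(1)] by metis
    then have "Z \<in> restr (restr E D) X \<union> restr (restr E D) Y"
      unfolding XY(5)[symmetric] by (simp add: restr_def)
    then have "Z \<subseteq> X \<or> Z \<subseteq> Y" by (auto simp: restr_def)
    then show False using Z XY(3) by blast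
  qed
qed

text \<open>Every block lies in \<open>D\<close>, so nested restrictions collapse to
  \<open>restr E C\<close>; the union equation then says exactly that each edge inside
  \<open>D\<close> lies inside a block.\<close>

lemma conn_components_iff:
  assumes "hypergraph E" "D \<subseteq> vertices E"
  shows "conn_components (restr E D) P \<longleftrightarrow> comps E D P"
proof -
  have "(\<forall>C\<in>P. hconnected (restr (restr E D) C)) \<longleftrightarrow> (\<forall>C\<in>P. conn E C)"
    "restr E D = (\<Union>C\<in>P. restr (restr E D) C) \<longleftrightarrow> (\<forall>Z\<in>E. Z \<subseteq> D \<longrightarrow> (\<exists>C\<in>P. Z \<subseteq> C))"
    if "partition_on D P"
  proof -
    have sub: "C \<subseteq> D" if "C \<in> P" for C using that \<open>partition_on D P\<close> by (auto simp: partition_on_def)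
    show "(\<forall>C\<in>P. hconnected (restr (restr E D) C)) \<longleftrightarrow> (\<forall>C\<in>P. conn E C)"
      using sub hconnected_restr_iff[OF assms(1)] assms(2)
      by (metis restr_restr subset_trans)
    have "restr (restr E D) C = restr E C" if "C \<in> P" for C using sub[OF that] by simp
    then have eq: "(\<Union>C\<in>P. restr (restr E D) C) = (\<Union>C\<in>P. restr E C)" by simp
    have eq': "(\<Union>C\<in>P. restr E C) = {Z\<in>E. \<exists>C\<in>P. Z \<subseteq> C}" by (auto simp: restr_def)
    have "{Z\<in>E. \<exists>C\<in>P. Z \<subseteq> C} \<subseteq> {Z\<in>E. Z \<subseteq> D}" using sub by fast
    then show "restr E D = (\<Union>C\<in>P. restr (restr E D) C) \<longleftrightarrow> (\<forall>Z\<in>E. Z \<subseteq> D \<longrightarrow> (\<exists>C\<in>P. Z \<subseteq> C))"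
      unfolding eq eq' unfolding restr_def by blast
  qed
  then show ?thesis
    unfolding conn_components_def comps_def vertices_restr[OF assms] by auto
qed

subsection \<open>Right-filled hypergraphs\<close>

text \<open>Right-filledness trades a vertex \<open>a < x\<close> of the edge for \<open>x\<close>
  while keeping \<open>b\<close>. Repeating this removes all vertices below \<open>x\<close>; when
  none is left, \<open>z\<close> itself must be \<open>x\<close>.\<close>

lemma right_filled_truncate:
  fixes E :: "'a::linorder set set"
  assumes "hypergraph E" "right_filled E" "x \<in> vertices E"
    and "Z \<in> E" "z \<in> Z" "z \<le> x" "b \<in> Z" "x < b"
  shows "\<exists>Y\<in>E. x \<in> Y \<and> b \<in> Y \<and> Y \<subseteq> insert x {z\<in>Z. x < z}"
  using assms(4-)
proof (induction "card {z\<in>Z. z < x}" arbitrary: Z z rule: less_induct)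
  case less
  show ?case
  proof (cases "\<exists>a\<in>Z. a < x")
    case False
    then have "z = x" "Z \<subseteq> insert x {z\<in>Z. x < z}" using less.prems by force+
    then show ?thesis using less.prems by blast
  next
    case True
    then obtain a where a: "a \<in> Z" "a < x" by blast
    have "a \<in> vertices E" "b \<in> vertices E" using a less.prems by auto
    then obtain Y where Y: "Y \<in> E" "{x, b} \<subseteq> Y" "Y \<subseteq> (Z - {a}) \<union> {x}"
      using assms(2,3) a less.prems unfolding right_filled_def by blast
    have fin: "finite Z"
      using assms(1) less.prems(1) unfolding hypergraph_def by (meson Union_upper finite_subset)
    have "{z\<in>Y. z < x} \<subset> {z\<in>Z. z < x}" using Y a by auto
    then have "card {z\<in>Y. z < x} < card {z\<in>Z. z < x}" using fin by (simp add: psubset_card_mono)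
    then obtain Y' where "Y' \<in> E" "x \<in> Y'" "b \<in> Y'" "Y' \<subseteq> insert x {z\<in>Y. x < z}"
      using less.hyps[of Y x] Y less.prems by auto
    moreover have "{z\<in>Y. x < z} \<subseteq> {z\<in>Z. x < z}" using Y by auto
    ultimately show ?thesis by blast
  qed
qed

text \<open>An edge of \<open>D\<close> leaving a set of elements above \<open>x\<close> either
  stays above \<open>x\<close> or can be truncated to an edge through \<open>x\<close>. The vertex
  \<open>x\<close> may lie outside \<open>D\<close>, and \<open>wb_comparable\<close> relies on
  this.\<close>

lemma right_filled_conn:
  fixes E :: "'a::linorder set set"
  assumes "hypergraph E" "right_filled E" "conn E D" "a \<in> D" "a \<le> x" "x \<in> vertices E"
  shows "conn E (insert x {d\<in>D. x < d})"
proof -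
  let ?K = "insert x {d\<in>D. x < d}"
  have cross: "\<exists>Z\<in>E. Z \<subseteq> ?K \<and> Z \<inter> B \<noteq> {} \<and> \<not> Z \<subseteq> B" if B: "B \<subseteq> {d\<in>D. x < d}" "B \<noteq> {}" for B
  proof -
    have "B \<noteq> D" "B \<subseteq> D" using B assms(4,5) by force+
    then obtain Z where Z: "Z \<in> E" "Z \<subseteq> D" "Z \<inter> B \<noteq> {}" "\<not> Z \<subseteq> B"
      using connE[OF assms(3) _ B(2)] by blast
    show ?thesis
    proof (cases "\<forall>z\<in>Z. x < z")
      case True
      then show ?thesis using Z by blast
    next
      case False
      then obtain z where z: "z \<in> Z" "z \<le> x" by force
      obtain b where b: "b \<in> Z" "b \<in> B" using Z by blast
      obtain Y where Y: "Y \<in> E" "x \<in> Y" "b \<in> Y" "Y \<subseteq> insert x {z\<in>Z. x < z}"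
        using right_filled_truncate[OF assms(1,2,6) Z(1) z b(1)] b B by blast
      have "x \<notin> B" using B by auto
      then show ?thesis using Y b Z(2) by (intro bexI[of _ Y]) auto
    qed
  qed
  show ?thesis
    unfolding conn_def
  proof (intro allI impI)
    fix A assume A: "A \<subseteq> ?K" "A \<noteq> {}" "A \<noteq> ?K"
    show "\<exists>Z\<in>E. Z \<subseteq> ?K \<and> Z \<inter> A \<noteq> {} \<and> \<not> Z \<subseteq> A"
    proof (cases "x \<in> A")
      case False
      then show ?thesis using cross[of A] A by blast
    next
      case True
      \<comment> \<open>An edge crosses \<open>A\<close> inside \<open>?K\<close> iff it crosses the
        complement of \<open>A\<close>, and the complement avoids \<open>x\<close>.\<close>
      then have "?K - A \<subseteq> {d\<in>D. x < d}" "?K - A \<noteq> {}" using A by auto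
      then obtain Z where "Z \<in> E" "Z \<subseteq> ?K" "Z \<inter> (?K - A) \<noteq> {}" "\<not> Z \<subseteq> ?K - A"
        using cross[of "?K - A"] by blast
      then show ?thesis by (intro bexI[of _ Z]) auto
    qed
  qed
qed

subsection \<open>Constructs\<close>

text \<open>For a construct of \<open>restr E D\<close> this is \<open>D\<close>, so the component
  on which a child lives can be read off the child.\<close>

definition supp :: "'a ctree \<Rightarrow> 'a set" where
  "supp S = \<Union> (nodes S)"

text \<open>Primitive recursion through a multiset has to go through \<open>image_mset\<close>;
  \<open>wbelow_Node\<close> is the readable form used from here on.\<close>

primrec wbelow :: "'a ctree \<Rightarrow> 'a \<Rightarrow> 'a \<Rightarrow> bool" where
  "wbelow (Node X ts) = (\<lambda>b a. a \<in> X \<and> b \<in> supp (Node X ts)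
     \<or> (\<exists>f \<in> set_mset (image_mset wbelow ts). f b a))"

lemma wbelow_Node:
  "wbelow (Node X ts) b a \<longleftrightarrow>
     a \<in> X \<and> b \<in> supp (Node X ts) \<or> (\<exists>t\<in>#ts. wbelow t b a)"
  by auto

declare wbelow.simps [simp del]

lemma supp_Node [simp]: "supp (Node X ts) = X \<union> (\<Union>t\<in>set_mset ts. supp t)"
  by (auto simp: supp_def)

text \<open>The chain \<open>card A\<close>, \<open>card (set_mset M)\<close>, \<open>size M\<close>
  is increasing with equal ends, so \<open>f\<close> is injective and no multiplicity exceeds one.
  With \<open>f = supp\<close>, the children of a construct form a set indexed by
  components.\<close>

lemma image_mset_eq_mset_setD:
  assumes "image_mset f M = mset_set A" "finite A"
  shows "f ` set_mset M = A" "inj_on f (set_mset M)" "M = mset_set (set_mset M)"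
proof -
  show im: "f ` set_mset M = A"
    using arg_cong[OF assms(1), of set_mset] assms(2) by simp
  have "size M = card A" using arg_cong[OF assms(1), of size] by simp
  moreover have sub: "mset_set (set_mset M) \<subseteq># M" by (simp add: subseteq_mset_def count_mset_set')
  then have "card (set_mset M) \<le> size M" using size_mset_mono by fastforce
  moreover have "card A \<le> card (set_mset M)" using im by (metis card_image_le finite_set_mset)
  ultimately have c: "card (f ` set_mset M) = card (set_mset M)" "size M = card (set_mset M)"
    using im by auto
  then show "inj_on f (set_mset M)" by (simp add: eq_card_imp_inj_on)
  have "size (mset_set (set_mset M)) = size M" using c by simp
  then show "M = mset_set (set_mset M)"
    using mset_subset_size[of "mset_set (set_mset M)" M] sub
    by (metis less_irrefl subset_mset.le_neq_trans)
qed

lemma comps_empty: "hypergraph E \<Longrightarrow> comps E {} P \<longleftrightarrow> P = {}"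
  unfolding hypergraph_def comps_def partition_on_def by (auto simp: disjoint_def)

lemma hypergraph_restr: "hypergraph E \<Longrightarrow> D \<subseteq> vertices E \<Longrightarrow> hypergraph (restr E D)"
  unfolding hypergraph_def restr_def by (auto intro: finite_subset)

lemma supp_construct:
  assumes "construct E S" "hypergraph E"
  shows "supp S = vertices E"
  using assms
proof (induction rule: construct.induct)
  case (one_node E)
  then show ?case by simp
next
  case (graft Y E P t)
  have sub: "vertices E - Y \<subseteq> vertices E" by auto
  have P: "comps E (vertices E - Y) P"
    using graft conn_components_iff[OF graft.prems sub] by (simp add: remove_def)
  then have part: "\<Union>P = vertices E - Y" "finite P" by (auto simp: comps_def partition_on_def)
  have "supp (t C) = C" if "C \<in> P" for C
  proof -
    have "C \<subseteq> vertices E" using that part by auto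
    then show ?thesis
      using graft.IH[OF that] hypergraph_restr[OF graft.prems] vertices_restr[OF graft.prems] by auto
  qed
  then have "supp (Node Y (image_mset t (mset_set P))) = Y \<union> \<Union>P"
    unfolding supp_Node using part(2) by auto
  then show ?case using part(1) graft.hyps(2) by blast
qed

context
  fixes E :: "'a set set"
  assumes hyp: "hypergraph E"
begin

lemma supp_construct_restr: "construct (restr E D) S \<Longrightarrow> D \<subseteq> vertices E \<Longrightarrow> supp S = D"
  using supp_construct hypergraph_restr[OF hyp] vertices_restr[OF hyp] by metis

text \<open>Merges both introduction rules into one condition: the one-node tree is the case
  \<open>X = D\<close>, since the empty set has only the empty decomposition. No indexing function
  for the subtrees remains, which makes multiset manipulations of the children easy.\<close>

lemma construct_Node_iff:
  assumes D: "D \<subseteq> vertices E"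
  shows "construct (restr E D) (Node X ts) \<longleftrightarrow> X \<noteq> {} \<and> X \<subseteq> D
     \<and> (\<exists>P. comps E (D - X) P \<and> image_mset supp ts = mset_set P)
     \<and> (\<forall>t\<in>#ts. construct (restr E (supp t)) t)" (is "?l \<longleftrightarrow> ?r")
proof
  have v: "vertices (restr E D) = D" using vertices_restr[OF hyp D] .
  have rem: "remove (restr E D) X = restr E (D - X)" for X
    by (simp add: remove_def v)
  have cc: "conn_components (restr E (D - X)) P \<longleftrightarrow> comps E (D - X) P" for X P
    using D by (intro conn_components_iff hyp) auto
  {
    assume ?l
    then show ?r
    proof cases
      case one_node
      then show ?thesis using comps_empty[OF hyp] v by auto
    next
      case (graft P t)
      have P: "comps E (D - X) P" using graft by (simp add: rem cc)
      then have fin: "finite P" and sub: "\<And>C. C \<in> P \<Longrightarrow> C \<subseteq> D"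
        by (auto simp: comps_def partition_on_def)
      have c: "construct (restr E C) (t C)" "supp (t C) = C" if "C \<in> P" for C
      proof -
        show 1: "construct (restr E C) (t C)"
          using graft(5)[OF that] sub[OF that] by simp
        then show "supp (t C) = C" using sub[OF that] D supp_construct_restr by blast
      qed
      have "image_mset supp ts = image_mset (\<lambda>C. C) (mset_set P)"
        unfolding graft(1) image_mset.compositionality
        by (rule image_mset_cong) (use c fin in auto)
      then show ?thesis using P graft fin c v by auto
    qed
  }
  {
    assume r: ?r
    then obtain P where P: "comps E (D - X) P" "image_mset supp ts = mset_set P" by blast
    have fin: "finite P" using P by (simp add: comps_def)
    note m = image_mset_eq_mset_setD[OF P(2) fin]
    show ?l
    proof (cases "X = D")
      case True
      then have "P = {}" using P comps_empty[OF hyp] by auto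
      then have "ts = {#}" using P by simp
      then show ?thesis using construct.one_node[of "restr E D"] True r v by simp
    next
      case False
      \<comment> \<open>The rule \<open>graft\<close> asks for a function from blocks to subtrees;
        it is the inverse of \<open>supp\<close>, which is injective on the children by
        \<open>m(2)\<close>.\<close>
      define g where "g = the_inv_into (set_mset ts) supp"
      have g: "g (supp t) = t" if "t \<in># ts" for t
        using that the_inv_into_f_f[OF m(2)] by (simp add: g_def)
      have sub: "\<And>C. C \<in> P \<Longrightarrow> C \<subseteq> D"
        using P by (auto simp: comps_def partition_on_def)
      have "image_mset g (mset_set P) = image_mset (\<lambda>t. t) ts"
        unfolding P(2)[symmetric] image_mset.compositionality
        by (rule image_mset_cong) (use g in auto)
      moreover have "construct (restr E D) (Node X (image_mset g (mset_set P)))"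
      proof (rule construct.graft)
        show "X \<noteq> {}" "X \<subset> vertices (restr E D)" using r False v by auto
        show "conn_components (remove (restr E D) X) P" using P by (simp add: rem cc)
        fix C assume C: "C \<in> P"
        then obtain t where t: "t \<in># ts" "supp t = C" using m(1) by auto
        then show "construct (restr (restr E D) C) (g C)" using r g sub[OF C] by auto
      qed
      ultimately show ?thesis by simp
    qed
  }
qed

end

lemma
  assumes "wbelow S b a"
  shows wbelow_supp: "a \<in> supp S" "b \<in> supp S"
proof -
  have "a \<in> supp S \<and> b \<in> supp S"
    using assms
  proof (induction S)
    case (Node X ts)
    then show ?case unfolding wbelow_Node supp_Node by blast
  qed
  then show "a \<in> supp S" "b \<in> supp S" by auto
qed

section \<open>Tree paths and the preorder\<close>

lemma parent_nodes: "parent S A B \<Longrightarrow> A \<in> nodes S \<and> B \<in> nodes S"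
proof (induction rule: parent.induct)
  case (root Y us ts X)
  then show ?case by force
next
  case (sub t ts X Y Z)
  then show ?case by auto
qed

lemma parent_wbelow: "parent S A B \<Longrightarrow> a \<in> A \<Longrightarrow> b \<in> B \<Longrightarrow> wbelow S b a"
proof (induction rule: parent.induct)
  case (root Y us ts X)
  then have "b \<in> supp (Node X ts)" unfolding supp_def by force
  with root(2) show ?case unfolding wbelow_Node by blast
next
  case (sub t ts X Y Z)
  then show ?case unfolding wbelow_Node by blast
qed

lemma parent_rtranclp_sub: "t \<in># ts \<Longrightarrow> (parent t)\<^sup>*\<^sup>* A B \<Longrightarrow> (parent (Node X ts))\<^sup>*\<^sup>* A B"
  by (metis mono_rtranclp parent.sub)

lemma root_reaches_supp:
  "b \<in> supp (Node X ts) \<Longrightarrow> \<exists>B\<in>nodes (Node X ts). b \<in> B \<and> (parent (Node X ts))\<^sup>*\<^sup>* X B"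
proof (induction "Node X ts" arbitrary: X ts)
  case (Node X ts)
  show ?case
  proof (cases "b \<in> X")
    case True
    then show ?thesis by auto
  next
    case False
    then obtain t where t: "t \<in># ts" "b \<in> supp t" using Node.prems unfolding supp_Node by blast
    obtain Y us where Y: "t = Node Y us" by (cases t)
    then obtain B where B: "B \<in> nodes t" "b \<in> B" "(parent t)\<^sup>*\<^sup>* Y B" using Node.hyps t by blast
    have "parent (Node X ts) X Y" using t(1) unfolding Y by (rule parent.root)
    then have "(parent (Node X ts))\<^sup>*\<^sup>* X B"
      using parent_rtranclp_sub[OF t(1) B(3)] by (rule converse_rtranclp_into_rtranclp)
    moreover have "B \<in> nodes (Node X ts)" using B t by auto
    ultimately show ?thesis using B(2) by blast
  qed
qed

lemma wbelow_path:
  "wbelow S b a \<Longrightarrow> \<exists>A\<in>nodes S. \<exists>B\<in>nodes S. a \<in> A \<and> b \<in> B \<and> (parent S)\<^sup>*\<^sup>* A B"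
proof (induction S)
  case (Node X ts)
  from Node.prems consider "a \<in> X" "b \<in> supp (Node X ts)" | t where "t \<in># ts" "wbelow t b a"
    unfolding wbelow_Node by blast
  then show ?case
  proof cases
    case 1
    then show ?thesis using root_reaches_supp[OF 1(2)] by auto
  next
    case 2
    then obtain A B where "A \<in> nodes t" "B \<in> nodes t" "a \<in> A" "b \<in> B" "(parent t)\<^sup>*\<^sup>* A B"
      using Node.IH by blast
    moreover have "nodes t \<subseteq> nodes (Node X ts)" using 2 by auto
    ultimately show ?thesis using parent_rtranclp_sub[OF 2(1)] by blast
  qed
qed

lemma contracts_supp: "contracts S U V S' \<Longrightarrow> supp S' = supp S"
proof (induction rule: contracts.induct)
  case (root X Y us ts)
  then show ?case unfolding supp_Node by auto
next
  case (sub s X Y s' Z ts)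
  then show ?case unfolding supp_Node by auto
qed

lemma contracts_nodes: "contracts S U V S' \<Longrightarrow> U \<in> nodes S \<and> V \<in> nodes S"
  by (induction rule: contracts.induct) auto

section \<open>Root label, children and their supports\<close>

context
  fixes E :: "'a set set"
  assumes hyp: "hypergraph E"
begin

lemma
  assumes "construct (restr E D) (Node X ts)" "D \<subseteq> vertices E"
  shows construct_root: "X \<noteq> {}" "X \<subseteq> D"
    and construct_comps: "comps E (D - X) (supp ` set_mset ts)"
    and construct_inj: "inj_on supp (set_mset ts)"
    and construct_mset: "ts = mset_set (set_mset ts)"
proof -
  obtain P where P: "comps E (D - X) P" "image_mset supp ts = mset_set P" "X \<noteq> {}" "X \<subseteq> D"
    using assms(1)[unfolded construct_Node_iff[OF hyp assms(2)]] by (elim conjE exE)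
  then have "finite P" by (simp add: comps_def)
  note m = image_mset_eq_mset_setD[OF P(2) this]
  have "comps E (D - X) (supp ` set_mset ts)" using P(1) unfolding m(1) .
  then show "comps E (D - X) (supp ` set_mset ts)" "inj_on supp (set_mset ts)"
    "ts = mset_set (set_mset ts)" "X \<noteq> {}" "X \<subseteq> D"
    using m(2,3) P(3,4) by blast+
qed

lemma
  assumes "construct (restr E D) (Node X ts)" "D \<subseteq> vertices E" "t \<in># ts"
  shows child_construct: "construct (restr E (supp t)) t"
    and child_subset: "supp t \<subseteq> D - X"
    and child_conn: "conn E (supp t)"
    and child_vertices: "supp t \<subseteq> vertices E"
proof -
  show "construct (restr E (supp t)) t"
    using assms(1,3)[unfolded construct_Node_iff[OF hyp assms(2)]] by simp
  have c: "comps E (D - X) (supp ` set_mset ts)" using construct_comps assms(1,2) .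
  then have "partition_on (D - X) (supp ` set_mset ts)" unfolding comps_def by (elim conjE)
  then show 1: "supp t \<subseteq> D - X"
    using assms(3) unfolding partition_on_def by blast
  show "conn E (supp t)" using c assms(3) by (simp add: comps_def)
  show "supp t \<subseteq> vertices E" using 1 assms(2) by blast
qed

lemma child_unique:
  assumes "construct (restr E D) (Node X ts)" "D \<subseteq> vertices E" "t \<in># ts" "t' \<in># ts"
    and "x \<in> supp t" "x \<in> supp t'"
  shows "t = t'"
proof -
  have "supp t = supp t'"
    using comps_disjoint[OF construct_comps[OF assms(1,2)] _ _ assms(5,6)] assms(3,4) by simp
  from inj_onD[OF construct_inj[OF assms(1,2)] this assms(3,4)] show ?thesis .
qed

lemma child_ex:
  assumes "construct (restr E D) (Node X ts)" "D \<subseteq> vertices E" "a \<in> D" "a \<notin> X"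
  shows "\<exists>t\<in>#ts. a \<in> supp t"
proof -
  have "\<Union>(supp ` set_mset ts) = D - X"
    using comps_Union[OF construct_comps[OF assms(1,2)]] .
  then show ?thesis using assms(3,4) by blast
qed

lemma wbelow_root:
  assumes "construct (restr E D) (Node X ts)" "D \<subseteq> vertices E" "a \<in> X"
  shows "wbelow (Node X ts) b a \<longleftrightarrow> b \<in> D"
  using wbelow_supp[of "Node X ts" b a] supp_construct_restr[OF hyp assms(1,2)] assms(3)
  unfolding wbelow_Node by blast

text \<open>The root label and the other children are disjoint from the support of \<open>t\<close>,
  so only \<open>t\<close> can place anything below \<open>a\<close>. Almost every induction
  descends through this equivalence.\<close>

lemma wbelow_child:
  assumes "construct (restr E D) (Node X ts)" "D \<subseteq> vertices E" "t \<in># ts" "a \<in> supp t"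
  shows "wbelow (Node X ts) b a \<longleftrightarrow> wbelow t b a"
proof -
  have "a \<notin> X" using child_subset[OF assms(1-3)] assms(4) by blast
  moreover have "t' = t" if "t' \<in># ts" "wbelow t' b a" for t'
    using child_unique[OF assms(1,2) that(1) assms(3)] wbelow_supp[OF that(2)] assms(4) by blast
  ultimately show ?thesis using assms(3) unfolding wbelow_Node by blast
qed

section \<open>Order-theoretic properties of the preorder\<close>

lemma wbelow_dom:
  assumes "construct (restr E D) S" "D \<subseteq> vertices E" "wbelow S b a"
  shows "a \<in> D" "b \<in> D"
  using wbelow_supp[OF assms(3)] supp_construct_restr[OF hyp assms(1,2)] by auto

lemma wbelow_refl:
  assumes "construct (restr E D) S" "D \<subseteq> vertices E" "a \<in> D"
  shows "wbelow S a a"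
  using assms
proof (induction S arbitrary: D rule: ctree.induct)
  case (Node X ts)
  note S = Node.prems(1,2)
  show ?case
  proof (cases "a \<in> X")
    case True
    then show ?thesis using wbelow_root[OF S] Node.prems by blast
  next
    case False
    then obtain t where t: "t \<in># ts" "a \<in> supp t" using child_ex[OF S] Node.prems by blast
    then show ?thesis
      using Node.IH[OF t(1) child_construct[OF S t(1)] child_vertices[OF S t(1)] t(2)]
        wbelow_child[OF S t] by simp
  qed
qed

lemma wbelow_trans:
  assumes "construct (restr E D) S" "D \<subseteq> vertices E" "wbelow S c b" "wbelow S b a"
  shows "wbelow S c a"
  using assms
proof (induction S arbitrary: D rule: ctree.induct)
  case (Node X ts)
  note S = Node.prems(1,2)
  note dom = wbelow_dom[OF S]
  show ?case
  proof (cases "a \<in> X")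
    case True
    then show ?thesis using wbelow_root[OF S] dom Node.prems by blast
  next
    case False
    then obtain t where t: "t \<in># ts" "a \<in> supp t" using child_ex[OF S] Node.prems dom by blast
    have ba: "wbelow t b a" using wbelow_child[OF S t] Node.prems by blast
    then have b: "b \<in> supp t" using wbelow_supp by fast
    have "wbelow t c b" using wbelow_child[OF S t(1) b] Node.prems by blast
    then show ?thesis
      using Node.IH[OF t(1) child_construct[OF S t(1)] child_vertices[OF S t(1)] _ ba]
        wbelow_child[OF S t] by simp
  qed
qed

text \<open>If neither element is in the root label, both lie in the child containing
  \<open>c\<close>, and the induction descends into it.\<close>

lemma wbelow_forest:
  assumes "construct (restr E D) S" "D \<subseteq> vertices E" "wbelow S c a" "wbelow S c b"
  shows "wbelow S a b \<or> wbelow S b a"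
  using assms
proof (induction S arbitrary: D rule: ctree.induct)
  case (Node X ts)
  note S = Node.prems(1,2)
  have dom: "a \<in> D" "b \<in> D" using wbelow_dom(1)[OF S] Node.prems(3,4) by auto
  show ?case
  proof (cases "a \<in> X \<or> b \<in> X")
    case True
    then show ?thesis using wbelow_root[OF S] dom by blast
  next
    case False
    then obtain t t' where t: "t \<in># ts" "a \<in> supp t" and t': "t' \<in># ts" "b \<in> supp t'"
      using child_ex[OF S] dom by metis
    have ba: "wbelow t c a" "wbelow t' c b"
      using wbelow_child[OF S t] wbelow_child[OF S t'] Node.prems(3,4) by simp_all
    then have "t' = t" using child_unique[OF S t'(1) t(1) wbelow_supp(2) wbelow_supp(2)] by auto
    then show ?thesis
      using Node.IH[OF t(1) child_construct[OF S t(1)]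
          child_vertices[OF S t(1)] ba(1)] ba(2)
        wbelow_child[OF S t] wbelow_child[OF S t'] by simp
  qed
qed

text \<open>If \<open>K\<close> meets the root label, any common element is greatest. Otherwise
  connectedness puts \<open>K\<close> inside one component, hence inside one child.\<close>

lemma conn_has_top:
  assumes "construct (restr E D) S" "D \<subseteq> vertices E" "conn E K" "K \<subseteq> D" "K \<noteq> {}"
  shows "\<exists>a\<in>K. \<forall>b\<in>K. wbelow S b a"
  using assms
proof (induction S arbitrary: D rule: ctree.induct)
  case (Node X ts)
  note S = Node.prems(1,2)
  show ?case
  proof (cases "K \<inter> X = {}")
    case False
    then show ?thesis using wbelow_root[OF S] Node.prems by blast
  next
    case True
    then have "K \<subseteq> D - X" using Node.prems by blast
    then obtain t where t: "t \<in># ts" "K \<subseteq> supp t"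
      using comps_conn[OF construct_comps[OF S] Node.prems(3) _ Node.prems(5)] by blast
    then obtain a where a: "a \<in> K" "\<forall>b\<in>K. wbelow t b a"
      using Node.IH[OF t(1) child_construct[OF S t(1)] child_vertices[OF S t(1)] Node.prems(3) t(2) Node.prems(5)]
      by blast
    then show ?thesis using wbelow_child[OF S t(1)] t(2) by blast
  qed
qed

text \<open>The down-set of \<open>a\<close> is the support of the subtree rooted at the node of
  \<open>a\<close>: either \<open>D\<close> itself or a component arising further down.\<close>

lemma conn_down:
  assumes "construct (restr E D) S" "D \<subseteq> vertices E" "conn E D" "a \<in> D"
  shows "conn E {b. wbelow S b a}"
  using assms
proof (induction S arbitrary: D rule: ctree.induct)
  case (Node X ts)
  note S = Node.prems(1,2)
  show ?case
  proof (cases "a \<in> X")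
    case True
    then show ?thesis using wbelow_root[OF S] Node.prems(3) by simp
  next
    case False
    then obtain t where t: "t \<in># ts" "a \<in> supp t" using child_ex[OF S] Node.prems by blast
    have "conn E {b. wbelow t b a}"
      using Node.IH[OF t(1) child_construct[OF S t(1)] child_vertices[OF S t(1)] child_conn[OF S t(1)] t(2)] .
    then show ?thesis using wbelow_child[OF S t] by simp
  qed
qed

section \<open>Nodes as equivalence classes of the preorder\<close>

lemma nodes_nonempty:
  assumes "construct (restr E D) S" "D \<subseteq> vertices E" "A \<in> nodes S"
  shows "A \<noteq> {}"
  using assms
proof (induction S arbitrary: D rule: ctree.induct)
  case (Node X ts)
  note S = Node.prems(1,2)
  show ?case
  proof (cases "A = X")
    case True
    then show ?thesis using construct_root[OF S] by blast
  next
    case False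
    then obtain t where t: "t \<in># ts" "A \<in> nodes t" using Node.prems by auto
    from Node.IH[OF t(1) child_construct[OF S t(1)] child_vertices[OF S t(1)] t(2)] show ?thesis .
  qed
qed

lemma node_eq:
  assumes "construct (restr E D) S" "D \<subseteq> vertices E" "A \<in> nodes S" "a \<in> A"
  shows "A = {b. wbelow S a b \<and> wbelow S b a}"
  using assms
proof (induction S arbitrary: D rule: ctree.induct)
  case (Node X ts)
  note S = Node.prems(1,2)
  have a: "a \<in> D" using Node.prems supp_construct_restr[OF hyp S] by (auto simp: supp_def)
  show ?case
  proof (cases "a \<in> X")
    case True
    have "A = X"
    proof (rule ccontr)
      assume "A \<noteq> X"
      then obtain t where t: "t \<in># ts" "A \<in> nodes t" using Node.prems by auto
      then have "a \<in> supp t" using Node.prems by (auto simp: supp_def)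
      then show False using child_subset[OF S t(1)] True by blast
    qed
    moreover have "b \<in> X" if b: "wbelow (Node X ts) a b" for b
    proof (rule ccontr)
      assume "b \<notin> X"
      then obtain t where t: "t \<in># ts" "b \<in> supp t"
        using child_ex[OF S] wbelow_dom[OF S b] by blast
      then have "a \<in> supp t" using b wbelow_child[OF S t] wbelow_supp(2)[of t a b] by simp
      then show False using child_subset[OF S t(1)] True by blast
    qed
    ultimately show ?thesis
      using wbelow_root[OF S] True a construct_root(2)[OF S] by blast
  next
    case False
    then obtain t where t: "t \<in># ts" "A \<in> nodes t" using Node.prems by auto
    then have at: "a \<in> supp t" using Node.prems by (auto simp: supp_def)
    have eq: "A = {b. wbelow t a b \<and> wbelow t b a}"
      using Node.IH[OF t(1) child_construct[OF S t(1)] child_vertices[OF S t(1)] t(2)]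
        Node.prems(4) by blast
    have "wbelow (Node X ts) a b \<longleftrightarrow> wbelow t a b" if "wbelow (Node X ts) b a" for b
    proof -
      have "b \<in> supp t" using that wbelow_child[OF S t(1) at] wbelow_supp(2)[of t b a] by simp
      then show ?thesis by (rule wbelow_child[OF S t(1)])
    qed
    then show ?thesis using wbelow_child[OF S t(1) at] unfolding eq by blast
  qed
qed

lemma node_unique:
  assumes "construct (restr E D) S" "D \<subseteq> vertices E" "A \<in> nodes S" "B \<in> nodes S" "a \<in> A" "a \<in> B"
  shows "A = B"
  using node_eq[OF assms(1,2,3,5)] node_eq[OF assms(1,2,4,6)] by simp

lemma same_node_iff:
  assumes "construct (restr E D) S" "D \<subseteq> vertices E"
  shows "same_node S a b \<longleftrightarrow> wbelow S a b \<and> wbelow S b a"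
proof
  assume "same_node S a b"
  then show "wbelow S a b \<and> wbelow S b a"
    using node_eq[OF assms] unfolding same_node_def by blast
next
  assume *: "wbelow S a b \<and> wbelow S b a"
  then obtain A where A: "A \<in> nodes S" "a \<in> A" using wbelow_supp[of S a b] by (auto simp: supp_def)
  then have "b \<in> A" using node_eq[OF assms A] * by blast
  with A show "same_node S a b" unfolding same_node_def by blast
qed

lemma parent_rtranclp_wbelow:
  assumes "construct (restr E D) S" "D \<subseteq> vertices E" "(parent S)\<^sup>*\<^sup>* A B"
  shows "A = B \<or> (\<forall>a\<in>A. \<forall>b\<in>B. wbelow S b a)"
  using assms(3)
proof (induction rule: rtranclp_induct)
  case base
  then show ?case by simp
next
  case (step B C)
  obtain b where b: "b \<in> B"
    using parent_nodes[OF step(2)] nodes_nonempty[OF assms(1,2)] by blast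
  have "wbelow S c a" if "a \<in> A" "c \<in> C" for a c
  proof (cases "A = B")
    case True
    then show ?thesis using parent_wbelow[OF step(2)] that by blast
  next
    case False
    then have "wbelow S b a" using step.IH that b by blast
    moreover have "wbelow S c b" using parent_wbelow[OF step(2) b] that by blast
    ultimately show ?thesis using wbelow_trans[OF assms(1,2)] by blast
  qed
  then show ?case by blast
qed

lemma below_iff:
  assumes "construct (restr E D) S" "D \<subseteq> vertices E"
  shows "below S b a \<longleftrightarrow> wbelow S b a \<and> \<not> wbelow S a b"
proof
  assume "below S b a"
  then obtain A B where AB: "A \<in> nodes S" "B \<in> nodes S" "a \<in> A" "b \<in> B" "A \<noteq> B"
    "(parent S)\<^sup>*\<^sup>* A B" unfolding below_def by blast
  then have "wbelow S b a" using parent_rtranclp_wbelow[OF assms] by blast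
  moreover have "\<not> wbelow S a b"
  proof
    assume "wbelow S a b"
    then have "b \<in> A" using node_eq[OF assms AB(1,3)] \<open>wbelow S b a\<close> by blast
    then show False using node_unique[OF assms AB(1,2) _ AB(4)] AB(5) by blast
  qed
  ultimately show "wbelow S b a \<and> \<not> wbelow S a b" by blast
next
  assume *: "wbelow S b a \<and> \<not> wbelow S a b"
  then obtain A B where AB: "A \<in> nodes S" "B \<in> nodes S" "a \<in> A" "b \<in> B" "(parent S)\<^sup>*\<^sup>* A B"
    using wbelow_path[of S b a] by blast
  moreover have "A \<noteq> B" using node_eq[OF assms AB(1,3)] AB(4) * by blast
  ultimately show "below S b a"
    unfolding below_def by (intro bexI[of _ A] bexI[of _ B] conjI)
qed

text \<open>The root label is the set of greatest elements, so the roots agree. The components are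
  then the same by \<open>comps_unique\<close>, children with equal support agree by induction, and
  the multiset of children is determined by its set.\<close>

lemma construct_eqI:
  assumes "construct (restr E D) S" "construct (restr E D) T" "D \<subseteq> vertices E"
    and "wbelow S = wbelow T"
  shows "S = T"
  using assms
proof (induction S arbitrary: T D rule: ctree.induct)
  case (Node X ts)
  obtain Y us where T: "T = Node Y us" by (cases T)
  note S' = Node.prems(1,3) and T' = Node.prems(2,3)[unfolded T] and eq = Node.prems(4)[unfolded T]
  have rt: "X = {a\<in>D. \<forall>b\<in>D. wbelow (Node X ts) b a}"
    if c: "construct (restr E D) (Node X ts)" for X ts
  proof -
    have "a \<in> X" if a: "a \<in> D" "\<forall>b\<in>D. wbelow (Node X ts) b a" for a
    proof (rule ccontr)
      assume "a \<notin> X"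
      then obtain t where t: "t \<in># ts" "a \<in> supp t" using child_ex[OF c S'(2)] a by blast
      obtain x where x: "x \<in> X" "x \<in> D" using construct_root[OF c S'(2)] by blast
      then have "x \<in> supp t" using wbelow_child[OF c S'(2) t] a(2) wbelow_supp(2)[of t x a] by simp
      then show False using child_subset[OF c S'(2) t(1)] x by blast
    qed
    then show ?thesis using wbelow_root[OF c S'(2)] construct_root(2)[OF c S'(2)] by blast
  qed
  have XY: "X = Y" using rt[OF S'(1)] rt[OF T'(1)] eq by simp
  have same: "t = u" if tu: "t \<in># ts" "u \<in># us" "supp t = supp u" for t u
  proof (rule Node.IH[OF tu(1)])
    show "construct (restr E (supp t)) t" "supp t \<subseteq> vertices E"
      by (rule child_construct[OF S' tu(1)] child_vertices[OF S' tu(1)])+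
    show "construct (restr E (supp t)) u"
      using child_construct[OF T' tu(2)] tu(3) by simp
    show "wbelow t = wbelow u"
    proof (intro ext)
      fix b a
      show "wbelow t b a = wbelow u b a"
        using wbelow_child[OF S' tu(1), of a b] wbelow_child[OF T' tu(2), of a b] tu(3) eq
          wbelow_supp(1)[of t b a] wbelow_supp(1)[of u b a] by auto
    qed
  qed
  have "supp ` set_mset ts = supp ` set_mset us"
    using comps_unique[OF construct_comps[OF S']] construct_comps[OF T'] XY by simp
  then have ex: "\<And>t. t \<in># ts \<Longrightarrow> \<exists>u\<in>#us. supp t = supp u" "\<And>u. u \<in># us \<Longrightarrow> \<exists>t\<in>#ts. supp t = supp u"
    by (auto simp: set_eq_iff image_iff) metis+
  have "set_mset ts \<subseteq> set_mset us" "set_mset us \<subseteq> set_mset ts"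
    using ex same by blast+
  then have "set_mset ts = set_mset us" by simp
  then have "mset_set (set_mset ts) = mset_set (set_mset us)" by simp
  then have "ts = us" unfolding construct_mset[OF S', symmetric] construct_mset[OF T', symmetric] .
  then show ?case using XY T by simp
qed

subsection \<open>Contraction and splitting\<close>

lemma construct_replace_child:
  assumes "construct (restr E D) (Node Z (add_mset s ts))" "D \<subseteq> vertices E"
    and "supp s' = supp s" "construct (restr E (supp s)) s'"
  shows "construct (restr E D) (Node Z (add_mset s' ts))"
  using assms unfolding construct_Node_iff[OF hyp assms(2)] by auto

text \<open>At the contracted edge, removing \<open>Y\<close> as well breaks the component
  \<open>supp ?s\<close> into the blocks \<open>Q\<close> and leaves the other blocks of
  \<open>P\<close> untouched.\<close>

lemma contracts_construct:
  assumes "contracts S U V S'" "construct (restr E D) S" "D \<subseteq> vertices E"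
  shows "construct (restr E D) S'"
  using assms
proof (induction arbitrary: D rule: contracts.induct)
  case (sub s X Y s' Z ts)
  have s: "construct (restr E (supp s)) s" "supp s \<subseteq> vertices E"
    using child_construct[OF sub.prems, of s] child_vertices[OF sub.prems, of s] by simp_all
  show ?case
    using construct_replace_child[OF sub.prems contracts_supp[OF sub.hyps] sub.IH[OF s]] .
next
  case (root X Y us ts)
  let ?s = "Node Y us"
  have sub: "supp ?s \<subseteq> vertices E" "supp ?s \<subseteq> D - X" and cs: "construct (restr E (supp ?s)) ?s"
    using child_vertices[OF root, of ?s] child_construct[OF root, of ?s] child_subset[OF root, of ?s]
    by (simp_all del: supp_Node)
  obtain P where P: "comps E (D - X) P" "image_mset supp (add_mset ?s ts) = mset_set P"
    using root(1)[unfolded construct_Node_iff[OF hyp root(2)]] by (elim conjE exE)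
  obtain Q where Q: "comps E (supp ?s - Y) Q" "image_mset supp us = mset_set Q"
    using cs[unfolded construct_Node_iff[OF hyp sub(1)]] by (elim conjE exE)
  have fin: "finite P" "finite Q" using P Q by (auto simp: comps_def)
  have parts: "partition_on (D - X) P" "partition_on (supp ?s - Y) Q"
    using P Q by (auto simp: comps_def)
  have sP: "supp ?s \<in> P"
    using image_mset_eq_mset_setD(1)[OF P(2) fin(1)] by (auto simp del: supp_Node)
  have dis: "C = supp ?s" if "C \<in> P" "x \<in> C" "x \<in> supp ?s" for C x
    using comps_disjoint[OF P(1) that(1) sP] that(2,3) by blast
  have Qs: "C \<subseteq> supp ?s - Y" "C \<noteq> {}" if "C \<in> Q" for C
    using parts(2) that unfolding partition_on_def by auto
  \<comment> \<open>Disjointness is what turns the multiset sum \<open>us + ts\<close> into the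
    \<open>mset_set\<close> of a union.\<close>
  have PQ: "(P - {supp ?s}) \<inter> Q = {}"
    using dis Qs by blast
  have ts: "image_mset supp ts = mset_set (P - {supp ?s})"
    using P(2) mset_set.remove[OF fin(1) sP] by (simp del: supp_Node)
  have "image_mset supp (us + ts) = mset_set (P - {supp ?s} \<union> Q)"
    using Q(2) ts PQ fin by (simp add: mset_set_Union)
  moreover have "comps E (D - (X \<union> Y)) (P - {supp ?s} \<union> Q)"
    unfolding comps_def
  proof (intro conjI)
    show "finite (P - {supp ?s} \<union> Q)" using fin by simp
    show "\<forall>C\<in>P - {supp ?s} \<union> Q. conn E C" using P Q by (auto simp: comps_def)
    show "\<forall>Z\<in>E. Z \<subseteq> D - (X \<union> Y) \<longrightarrow> (\<exists>C\<in>P - {supp ?s} \<union> Q. Z \<subseteq> C)"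
    proof (intro ballI impI)
      fix Z assume Z: "Z \<in> E" "Z \<subseteq> D - (X \<union> Y)"
      then obtain C where C: "C \<in> P" "Z \<subseteq> C" using P(1) unfolding comps_def by blast
      show "\<exists>C\<in>P - {supp ?s} \<union> Q. Z \<subseteq> C"
      proof (cases "C = supp ?s")
        case True
        then have "Z \<subseteq> supp ?s - Y" using C Z by blast
        then show ?thesis using Q(1) Z unfolding comps_def by blast
      next
        case False
        then show ?thesis using C by blast
      qed
    qed
    show "partition_on (D - (X \<union> Y)) (P - {supp ?s} \<union> Q)"
    proof (rule partition_onI)
      have Y: "Y \<subseteq> supp ?s" by auto
      have uP: "\<Union>P = D - X" and uQ: "\<Union>Q = supp ?s - Y"
        using comps_Union[OF P(1)] comps_Union[OF Q(1)] .
      have "\<Union>(P - {supp ?s}) = D - X - supp ?s"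
        using uP sP dis by blast
      then have "\<Union>(P - {supp ?s} \<union> Q) = (D - X - supp ?s) \<union> (supp ?s - Y)"
        using uQ unfolding Union_Un_distrib by simp
      also have "\<dots> = D - (X \<union> Y)" using sub(2) Y by blast
      finally show "\<Union>(P - {supp ?s} \<union> Q) = D - (X \<union> Y)" .
      show "{} \<notin> P - {supp ?s} \<union> Q"
        using partition_onD3[OF parts(1)] partition_onD3[OF parts(2)] by blast
      show "disjnt p q" if "p \<in> P - {supp ?s} \<union> Q" "q \<in> P - {supp ?s} \<union> Q" "p \<noteq> q" for p q
        using that comps_disjoint[OF P(1)] comps_disjoint[OF Q(1)] dis Qs(1) unfolding disjnt_def
        by blast
    qed
  qed
  moreover have "\<forall>t\<in>#us + ts. construct (restr E (supp t)) t"
    using child_construct[OF root] child_construct[OF cs sub(1)] by auto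
  moreover have "Y \<subseteq> D" using sub(2) by auto
  ultimately show ?case
    using construct_root[OF root] unfolding construct_Node_iff[OF hyp root(2)] by blast
qed

text \<open>The only effect on the preorder is that \<open>V\<close> is lifted to the level of
  \<open>U\<close>: whatever was below \<open>U\<close> becomes weakly below \<open>V\<close>
  too.\<close>

lemma contracts_wbelow:
  assumes "contracts S U V S'" "construct (restr E D) S" "D \<subseteq> vertices E"
  shows "wbelow S' b a \<longleftrightarrow> wbelow S b a \<or> (a \<in> V \<and> (\<exists>u\<in>U. wbelow S b u))"
  using assms
proof (induction arbitrary: D rule: contracts.induct)
  case (root X Y us ts)
  have "supp (Node X (add_mset (Node Y us) ts)) = D"
    "supp (Node (X \<union> Y) (us + ts)) = D"
    using supp_construct_restr[OF hyp] root contracts_construct[OF contracts.root] by blast+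
  moreover have "supp (Node Y us) \<subseteq> D"
    using child_subset[OF root, of "Node Y us"] by (auto simp del: supp_Node)
  ultimately show ?case
    using wbelow_root[OF root] construct_root(1)[OF root] unfolding wbelow_Node[of "X \<union> Y"]
    by (auto simp: wbelow_Node simp del: supp_Node)
next
  case (sub s X Y s' Z ts)
  have s: "construct (restr E (supp s)) s" "supp s \<subseteq> vertices E"
    using child_construct[OF sub.prems, of s] child_vertices[OF sub.prems, of s] by simp_all
  have "wbelow s' b a \<longleftrightarrow> wbelow s b a \<or> (a \<in> Y \<and> (\<exists>u\<in>X. wbelow s b u))" using sub.IH[OF s] .
  moreover have "wbelow (Node Z (add_mset s ts)) b u \<longleftrightarrow> wbelow s b u" if "u \<in> X" for u
  proof -
    have "u \<in> supp s" using contracts_nodes[OF sub.hyps] that unfolding supp_def by blast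
    then show ?thesis using wbelow_child[OF sub.prems, of s] by simp
  qed
  moreover have "supp (Node Z (add_mset s ts)) = supp (Node Z (add_mset s' ts))"
    using contracts_supp[OF sub.hyps] unfolding supp_Node by simp
  ultimately show ?case
    by (auto simp: wbelow_Node simp del: supp_Node)
qed

text \<open>Parent and child form a covering pair of the preorder: an element between them outside
  \<open>X\<close> and \<open>Y\<close> would lie in a child of \<open>?s\<close>, and that child
  would then contain \<open>v\<close>, although \<open>v\<close> is in \<open>Y\<close>.\<close>

lemma contracts_cover:
  assumes "contracts S U V S'" "construct (restr E D) S" "D \<subseteq> vertices E" "u \<in> U" "v \<in> V"
  shows "wbelow S v u \<and> \<not> wbelow S u v
    \<and> (\<forall>x. wbelow S v x \<longrightarrow> wbelow S x u \<longrightarrow> x \<in> U \<union> V)"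
  using assms
proof (induction arbitrary: D rule: contracts.induct)
  case (root X Y us ts)
  let ?S = "Node X (add_mset (Node Y us) ts)" and ?s = "Node Y us"
  have s: "construct (restr E (supp ?s)) ?s" "supp ?s \<subseteq> vertices E" "supp ?s \<subseteq> D - X"
    using child_construct[OF root(1,2), of ?s] child_vertices[OF root(1,2), of ?s]
      child_subset[OF root(1,2), of ?s]
    by (simp_all del: supp_Node)
  have v: "v \<in> supp ?s" using root by auto
  have ch: "wbelow ?S b a \<longleftrightarrow> wbelow ?s b a" if "a \<in> supp ?s" for a b
    using wbelow_child[OF root(1,2) _ that] by simp
  have "wbelow ?S v u" using wbelow_root[OF root(1,2,3)] v s by blast
  moreover have "\<not> wbelow ?S u v" using ch[OF v] wbelow_supp(2)[of ?s u v] s(3) root(3) by blast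
  moreover have "x \<in> X \<union> Y" if x: "wbelow ?S v x" "wbelow ?S x u" for x
  proof (rule ccontr)
    assume x': "x \<notin> X \<union> Y"
    then obtain t where t: "t \<in># add_mset ?s ts" "x \<in> supp t"
      using child_ex[OF root(1,2)] wbelow_dom[OF root(1,2) x(1)] by blast
    then have "v \<in> supp t" using x(1) wbelow_child[OF root(1,2) t] wbelow_supp(2)[of t v x] by simp
    then have "t = ?s" using child_unique[OF root(1,2) t(1) _ _ v] by auto
    with t(2) have "x \<in> supp ?s" by simp
    then obtain t' where t': "t' \<in># us" "x \<in> supp t'" using x' unfolding supp_Node by blast
    have "wbelow t' v x" using ch wbelow_child[OF s(1,2) t'] x(1) t \<open>t = ?s\<close> by simp
    then have "v \<in> supp t'" by (rule wbelow_supp(2))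
    then show False using child_subset[OF s(1,2) t'(1)] root(4) by blast
  qed
  ultimately show ?case by blast
next
  case (sub s X Y s' Z ts)
  have s: "construct (restr E (supp s)) s" "supp s \<subseteq> vertices E"
    using child_construct[OF sub.prems(1,2), of s] child_vertices[OF sub.prems(1,2), of s]
    by simp_all
  have uv: "u \<in> supp s" "v \<in> supp s" using contracts_nodes[OF sub.hyps] sub.prems(3,4) unfolding supp_def by blast+
  have "wbelow (Node Z (add_mset s ts)) b a \<longleftrightarrow> wbelow s b a" if "a \<in> supp s" for a b
    using wbelow_child[OF sub.prems(1,2), of s] that by simp
  then have 1: "wbelow (Node Z (add_mset s ts)) b a \<longleftrightarrow> wbelow s b a" if "a \<in> supp s" for a b
    using that by simp
  have "x \<in> supp s" if "wbelow (Node Z (add_mset s ts)) x u" for x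
    using that wbelow_supp(2)[of s x u] 1[OF uv(1)] by simp
  then show ?case using sub.IH[OF s sub.prems(3,4)] uv 1 by meson
qed

text \<open>Converse of \<open>contracts_cover\<close>: it produces a contractible edge from purely
  order-theoretic data.\<close>

lemma cover_contracts:
  assumes "construct (restr E D) S" "D \<subseteq> vertices E" "wbelow S v u" "\<not> wbelow S u v"
    and "\<And>x. wbelow S v x \<Longrightarrow> wbelow S x u \<Longrightarrow> wbelow S x v \<or> wbelow S u x"
  shows "\<exists>S'. contracts S {x. wbelow S u x \<and> wbelow S x u} {x. wbelow S v x \<and> wbelow S x v} S'"
  using assms
proof (induction S arbitrary: D rule: ctree.induct)
  case (Node X ts)
  note S = Node.prems(1,2)
  let ?S = "Node X ts"
  note cl = node_eq[OF S]
  have dom: "u \<in> D" "v \<in> D" using wbelow_dom[OF S Node.prems(3)] .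
  show ?case
  proof (cases "u \<in> X")
    case True
    then have "v \<notin> X" using Node.prems(4) wbelow_root[OF S] dom by blast
    then obtain t where t: "t \<in># ts" "v \<in> supp t" using child_ex[OF S] dom by blast
    obtain Y us where Y: "t = Node Y us" by (cases t)
    have c: "construct (restr E (supp t)) (Node Y us)" "supp t \<subseteq> vertices E"
      using child_construct[OF S t(1)] child_vertices[OF S t(1)] Y by auto
    \<comment> \<open>Any \<open>y\<close> in the root label of the child lies between
      \<open>v\<close> and \<open>u\<close> and is not equivalent to \<open>u\<close>, so the
      covering hypothesis makes it equivalent to \<open>v\<close>.\<close>
    have "v \<in> Y"
    proof -
      obtain y where y: "y \<in> Y" using construct_root[OF c] by blast
      then have yt: "y \<in> supp t" using Y by auto
      have "wbelow t v y" using wbelow_root[OF c y] t Y by blast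
      then have vy: "wbelow ?S v y" using wbelow_child[OF S t(1) yt] by blast
      have "wbelow ?S y u" using wbelow_root[OF S True] child_subset[OF S t(1)] yt by blast
      moreover have "\<not> wbelow ?S u y"
        using wbelow_child[OF S t(1) yt] wbelow_supp(2)[of t u y] child_subset[OF S t(1)] True by blast
      ultimately have "wbelow ?S y v" using Node.prems(5)[OF vy] by blast
      then have "wbelow t y v" using wbelow_child[OF S t] by blast
      then show ?thesis using node_eq[OF c _ y] \<open>wbelow t v y\<close> Y by auto
    qed
    have "X \<in> nodes ?S" "Y \<in> nodes ?S" using t Y by force+
    then have eq: "X = {x. wbelow ?S u x \<and> wbelow ?S x u}" "Y = {x. wbelow ?S v x \<and> wbelow ?S x v}"
      using cl True \<open>v \<in> Y\<close> by blast+
    obtain ts' where "ts = add_mset t ts'" using t(1) by (metis multi_member_split)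
    then show ?thesis using contracts.root[of X Y us ts'] Y unfolding eq[symmetric] by blast
  next
    case False
    then obtain t where t: "t \<in># ts" "u \<in> supp t" using child_ex[OF S] dom by blast
    have ch: "wbelow ?S b a \<longleftrightarrow> wbelow t b a" if "a \<in> supp t" for a b
      using wbelow_child[OF S t(1) that] .
    have v: "v \<in> supp t" using ch[OF t(2)] Node.prems(3) wbelow_supp(2)[of t v u] by simp
    have "\<exists>t'. contracts t {x. wbelow t u x \<and> wbelow t x u} {x. wbelow t v x \<and> wbelow t x v} t'"
    proof (rule Node.IH[OF t(1) child_construct[OF S t(1)] child_vertices[OF S t(1)]])
      show "wbelow t v u" "\<not> wbelow t u v" using ch t v Node.prems by blast+
      show "wbelow t x v \<or> wbelow t u x" if "wbelow t v x" "wbelow t x u" for x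
        using that Node.prems(5)[of x] ch[OF v] ch[OF t(2)] ch[OF wbelow_supp(1)[OF that(1)]] by simp
    qed
    moreover have "wbelow t a x \<and> wbelow t x a \<longleftrightarrow> wbelow ?S a x \<and> wbelow ?S x a"
      if "a \<in> supp t" for a x
      using ch[OF that, of x] ch[of x a] wbelow_supp(2)[of t x a] by blast
    then have "{x. wbelow t u x \<and> wbelow t x u} = {x. wbelow ?S u x \<and> wbelow ?S x u}"
      "{x. wbelow t v x \<and> wbelow t x v} = {x. wbelow ?S v x \<and> wbelow ?S x v}"
      using v t(2) by simp_all
    moreover obtain ts' where "ts = add_mset t ts'" using t(1) by (metis multi_member_split)
    ultimately show ?thesis using contracts.sub[of t _ _ _ X ts'] by (simp, blast)
  qed
qed

end

text \<open>With \<open>V\<close> kept as the upper node, \<open>U\<close> must be the root label of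
  one component of the rest. Right-filledness guarantees that all of \<open>U\<close> lies in a
  single component.\<close>

lemma split_construct:
  fixes E :: "'a::linorder set set"
  assumes "hypergraph E" "right_filled E"
    and "construct (restr E D) S" "D \<subseteq> vertices E" "conn E D"
    and "V \<union> U \<in> nodes S" "V \<noteq> {}" "U \<noteq> {}" "\<And>v u. v \<in> V \<Longrightarrow> u \<in> U \<Longrightarrow> v < u"
  shows "\<exists>S'. construct (restr E D) S' \<and> contracts S' V U S"
  using assms(3-6)
proof (induction S arbitrary: D rule: ctree.induct)
  case (Node X ts)
  note S = Node.prems(1,2)
  show ?case
  proof (cases "V \<union> U = X")
    case False
    then obtain t where t: "t \<in># ts" "V \<union> U \<in> nodes t" using Node.prems by auto
    then obtain t' where t': "construct (restr E (supp t)) t'" "contracts t' V U t"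
      using Node.IH[OF t(1) child_construct[OF assms(1) S t(1)] child_vertices[OF assms(1) S t(1)]
          child_conn[OF assms(1) S t(1)] t(2)] by blast
    obtain ts' where ts: "ts = add_mset t ts'" using t(1) by (metis multi_member_split)
    have "construct (restr E D) (Node X (add_mset t' ts'))"
      using construct_replace_child[OF assms(1)] S t' contracts_supp[OF t'(2)] unfolding ts by metis
    moreover have "contracts (Node X (add_mset t' ts')) V U (Node X ts)"
      unfolding ts using contracts.sub[OF t'(2)] .
    ultimately show ?thesis by blast
  next
    case True
    have finD: "finite D" using assms(1) S(2) unfolding hypergraph_def by (meson finite_subset)
    have UV: "U \<subseteq> D" "V \<subseteq> D" using construct_root[OF assms(1) S] True by auto
    have dj: "V \<inter> U = {}" using assms(9) by blast
    have finU: "finite U" using UV finD finite_subset by blast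
    define u where "u = Min U"
    have u: "u \<in> U" "\<And>x. x \<in> U \<Longrightarrow> u \<le> x"
      using finU assms(8) by (auto simp: u_def)
    let ?\<C> = "{C. conn E C \<and> u \<in> C \<and> C \<subseteq> D - V}"
    \<comment> \<open>The component of \<open>D - V\<close> containing \<open>u\<close>, built
      directly as the union of all connected subsets through \<open>u\<close>.\<close>
    define K where "K = \<Union>?\<C>"
    have K: "conn E K" "K \<subseteq> D - V"
      using conn_Union[of ?\<C> E u] by (auto simp: K_def)
    \<comment> \<open>Truncating \<open>D\<close> at its own element \<open>u\<close> gives a
      connected set that contains \<open>U\<close>, as \<open>u\<close> is its minimum, and misses
      \<open>V\<close>, whose elements are all below \<open>u\<close>.\<close>
    have "conn E (insert u {d\<in>D. u < d})"
      using right_filled_conn[OF assms(1,2) Node.prems(3), of u u] UV S(2) u(1) by blast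
    moreover have "insert u {d\<in>D. u < d} \<subseteq> D - V"
      using u(1) UV dj assms(9) by (auto dest: less_asym)
    ultimately have "insert u {d\<in>D. u < d} \<subseteq> K" by (auto simp: K_def)
    then have UK: "U \<subseteq> K" using u UV by (auto simp: order_le_less)
    have Kmax: "C \<subseteq> K" if "conn E C" "C \<subseteq> D - V" "x \<in> C" "x \<in> K" for C x
    proof -
      have "C \<union> K \<in> ?\<C>" using conn_Un[OF that(1) K(1) that(3,4)] that K UK u(1) by blast
      then show ?thesis by (auto simp: K_def)
    qed
    obtain P where P: "comps E (D - X) P" "image_mset supp ts = mset_set P"
      using S(1)[unfolded construct_Node_iff[OF assms(1) S(2)]] by (elim conjE exE)
    have fin: "finite P" and part: "partition_on (D - X) P" and conn: "\<And>C. C \<in> P \<Longrightarrow> conn E C"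
      using P by (auto simp: comps_def)
    have sub: "C \<subseteq> D - X" "C \<noteq> {}" if "C \<in> P" for C
      using part that unfolding partition_on_def by auto
    have uP: "\<Union>P = D - X" using comps_Union[OF P(1)] .
    \<comment> \<open>Each old child component lies inside \<open>K\<close> or misses it; the former
      go below \<open>U\<close>, the latter stay directly below \<open>V\<close>.\<close>
    have dich: "C \<subseteq> K" if "C \<in> P" "x \<in> C" "x \<in> K" for C x
      using Kmax[OF conn[OF that(1)] _ that(2,3)] sub(1)[OF that(1)] True by blast
    let ?us = "filter_mset (\<lambda>t. supp t \<subseteq> K) ts" and ?rs = "filter_mset (\<lambda>t. \<not> supp t \<subseteq> K) ts"
    have us: "image_mset supp ?us = mset_set {C\<in>P. C \<subseteq> K}"
    proof -
      have "image_mset supp ?us = filter_mset (\<lambda>C. C \<subseteq> K) (image_mset supp ts)"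
        by (simp add: filter_mset_image_mset)
      then show ?thesis using fin unfolding P(2) by simp
    qed
    have rs: "image_mset supp ?rs = mset_set {C\<in>P. \<not> C \<subseteq> K}"
    proof -
      have "image_mset supp ?rs = filter_mset (\<lambda>C. \<not> C \<subseteq> K) (image_mset supp ts)"
        by (simp add: filter_mset_image_mset)
      then show ?thesis using fin unfolding P(2) by simp
    qed
    have cU: "comps E (K - U) {C\<in>P. C \<subseteq> K}"
      unfolding comps_def
    proof (intro conjI)
      show "finite {C\<in>P. C \<subseteq> K}" using fin by simp
      show "\<forall>C\<in>{C\<in>P. C \<subseteq> K}. conn E C" using conn by simp
      show "partition_on (K - U) {C\<in>P. C \<subseteq> K}"
      proof (rule partition_onI)
        have KU: "K - U \<subseteq> \<Union>P" using K(2) True uP by blast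
        show "\<Union>{C\<in>P. C \<subseteq> K} = K - U"
        proof
          show "\<Union>{C\<in>P. C \<subseteq> K} \<subseteq> K - U" using sub(1) True by fast
          show "K - U \<subseteq> \<Union>{C\<in>P. C \<subseteq> K}"
          proof
            fix x assume x: "x \<in> K - U"
            then obtain C where C: "C \<in> P" "x \<in> C" using KU by blast
            then have "C \<subseteq> K" using dich[OF C] x by simp
            with C show "x \<in> \<Union>{C\<in>P. C \<subseteq> K}" by blast
          qed
        qed
        show "{} \<notin> {C\<in>P. C \<subseteq> K}" using sub by blast
        show "disjnt p q" if "p \<in> {C\<in>P. C \<subseteq> K}" "q \<in> {C\<in>P. C \<subseteq> K}" "p \<noteq> q" for p q
          using that comps_disjoint[OF P(1), of p q] unfolding disjnt_def by blast
      qed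
      show "\<forall>Z\<in>E. Z \<subseteq> K - U \<longrightarrow> (\<exists>C\<in>{C\<in>P. C \<subseteq> K}. Z \<subseteq> C)"
      proof (intro ballI impI)
        fix Z assume Z: "Z \<in> E" "Z \<subseteq> K - U"
        then have "Z \<subseteq> D - X" using K(2) True by blast
        then obtain C where C: "C \<in> P" "Z \<subseteq> C" using P(1) Z(1) unfolding comps_def by blast
        obtain z where z: "z \<in> Z" using assms(1) Z(1) unfolding hypergraph_def by (metis ex_in_conv)
        then have "C \<subseteq> K" using dich[OF C(1), of z] C(2) Z(2) by blast
        then show "\<exists>C\<in>{C\<in>P. C \<subseteq> K}. Z \<subseteq> C" using C by blast
      qed
    qed
    have suppU: "supp (Node U ?us) = K"
    proof -
      have "supp ` set_mset ?us = {C\<in>P. C \<subseteq> K}"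
        using arg_cong[OF us, of set_mset] fin by simp
      then have "(\<Union>t\<in>set_mset ?us. supp t) = K - U"
        using cU unfolding comps_def partition_on_def by simp
      then show ?thesis using UK unfolding supp_Node by blast
    qed
    have KE: "K \<subseteq> vertices E" using K(2) S(2) by blast
    have "construct (restr E K) (Node U ?us)"
      unfolding construct_Node_iff[OF assms(1) KE]
      using assms(8) UK cU us child_construct[OF assms(1) S] by auto
    moreover have "comps E (D - V) (insert K {C\<in>P. \<not> C \<subseteq> K})"
      unfolding comps_def
    proof (intro conjI)
      show "finite (insert K {C\<in>P. \<not> C \<subseteq> K})" using fin by simp
      show "\<forall>C\<in>insert K {C\<in>P. \<not> C \<subseteq> K}. conn E C" using conn K(1) by simp
      show "partition_on (D - V) (insert K {C\<in>P. \<not> C \<subseteq> K})"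
      proof (rule partition_onI)
        have "D - V \<subseteq> K \<union> \<Union>P" using True UK uP by blast
        then have "D - V \<subseteq> \<Union>(insert K {C\<in>P. \<not> C \<subseteq> K})" by blast
        moreover have "\<Union>{C\<in>P. \<not> C \<subseteq> K} \<subseteq> D - V" using sub(1) True by fast
        ultimately show "\<Union>(insert K {C\<in>P. \<not> C \<subseteq> K}) = D - V" using K(2) by auto
        show "{} \<notin> insert K {C\<in>P. \<not> C \<subseteq> K}" using sub UK u(1) by blast
        show "disjnt p q"
          if "p \<in> insert K {C\<in>P. \<not> C \<subseteq> K}" "q \<in> insert K {C\<in>P. \<not> C \<subseteq> K}" "p \<noteq> q" for p q
          using that comps_disjoint[OF P(1), of p q] dich[of p] dich[of q] unfolding disjnt_def
          by blast
      qed
      show "\<forall>Z\<in>E. Z \<subseteq> D - V \<longrightarrow> (\<exists>C\<in>insert K {C\<in>P. \<not> C \<subseteq> K}. Z \<subseteq> C)"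
      proof (intro ballI impI)
        fix Z assume Z: "Z \<in> E" "Z \<subseteq> D - V"
        show "\<exists>C\<in>insert K {C\<in>P. \<not> C \<subseteq> K}. Z \<subseteq> C"
        proof (cases "Z \<inter> K = {}")
          case False
          then show ?thesis using Kmax[OF conn_edge[OF Z(1)] Z(2)] by blast
        next
          case zk: True
          then have "Z \<subseteq> D - X" using Z True UK by blast
          then obtain C where C: "C \<in> P" "Z \<subseteq> C" using P(1) Z(1) unfolding comps_def by blast
          then show ?thesis by blast
        qed
      qed
    qed
    moreover have "image_mset supp (add_mset (Node U ?us) ?rs) = mset_set (insert K {C\<in>P. \<not> C \<subseteq> K})"
      using rs fin suppU by simp
    ultimately have "construct (restr E D) (Node V (add_mset (Node U ?us) ?rs))"
      unfolding construct_Node_iff[OF assms(1) S(2)]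
      using assms(7) UV suppU child_construct[OF assms(1) S] by auto
    moreover have "contracts (Node V (add_mset (Node U ?us) ?rs)) V U (Node X ts)"
      using contracts.root[of V U ?us ?rs] True by (simp add: multiset_partition[symmetric])
    ultimately show ?thesis by blast
  qed
qed

subsection \<open>The flip order and inversions\<close>

lemma set_less_iff:
  fixes U V :: "'a::linorder set"
  assumes "finite V" "finite U" "V \<noteq> {}" "U \<noteq> {}"
  shows "set_less V U \<longleftrightarrow> (\<forall>v\<in>V. \<forall>u\<in>U. v < u)"
  unfolding set_less_def using assms by auto

text \<open>The inversion condition rewritten pair by pair: weak or strict inversions stay at least
  weak, and strict ones stay strict. In this form transitivity is immediate;
  \<open>inv_le_iff\<close> gives the agreement for constructs.\<close>

definition inv_le :: "'a::linorder ctree \<Rightarrow> 'a ctree \<Rightarrow> bool" where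
  "inv_le S T \<longleftrightarrow> (\<forall>a b. a < b \<longrightarrow> wbelow S b a \<longrightarrow>
     wbelow T b a \<and> (\<not> wbelow S a b \<longrightarrow> \<not> wbelow T a b))"

lemma inv_leD:
  assumes "inv_le S T" "a < b" "wbelow S b a"
  shows "wbelow T b a" "\<not> wbelow S a b \<Longrightarrow> \<not> wbelow T a b"
  using assms unfolding inv_le_def by blast+

lemma inv_le_trans: "inv_le S T \<Longrightarrow> inv_le T R \<Longrightarrow> inv_le S R"
  unfolding inv_le_def by blast

text \<open>Strictly increases along flips, hence provides the termination measure.\<close>

definition inversion_code :: "'a::linorder ctree \<Rightarrow> ('a \<times> 'a + 'a \<times> 'a) set" where
  "inversion_code S = {(a, b). a < b \<and> wbelow S b a} <+> {(a, b). a < b \<and> wbelow S b a \<and> \<not> wbelow S a b}"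

lemma inv_le_inversion_code: "inv_le S T \<Longrightarrow> inversion_code S \<subseteq> inversion_code T"
  unfolding inv_le_def inversion_code_def by blast

context
  fixes E :: "'a::linorder set set"
  assumes hyp: "hypergraph E" and con: "hconnected E" and rf: "right_filled E"
begin

lemma conn_vertices: "conn E (vertices E)"
  using con hconnected_restr_iff[OF hyp subset_refl] by simp

section \<open>Specialisation to the full vertex set\<close>

lemmas wb_dom = wbelow_dom[OF hyp, where D = "\<Union>E", unfolded restr_vertices, OF _ subset_refl]
lemmas wb_refl = wbelow_refl[OF hyp, where D = "\<Union>E", unfolded restr_vertices, OF _ subset_refl]
lemmas wb_trans = wbelow_trans[OF hyp, where D = "\<Union>E", unfolded restr_vertices, OF _ subset_refl]
lemmas wb_forest = wbelow_forest[OF hyp, where D = "\<Union>E", unfolded restr_vertices, OF _ subset_refl]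
lemmas top_ex = conn_has_top[OF hyp, where D = "\<Union>E", unfolded restr_vertices, OF _ subset_refl]
lemmas down_conn = conn_down[OF hyp, where D = "\<Union>E", unfolded restr_vertices,
    OF _ subset_refl conn_vertices]
lemmas wb_node = node_eq[OF hyp, where D = "\<Union>E", unfolded restr_vertices, OF _ subset_refl]
lemmas wb_contracts = contracts_wbelow[OF hyp, where D = "\<Union>E", unfolded restr_vertices,
    OF _ _ subset_refl]
lemmas wb_cover = contracts_cover[OF hyp, where D = "\<Union>E", unfolded restr_vertices,
    OF _ _ subset_refl]

lemma Inv_iff:
  assumes "construct E S"
  shows "(a, b) \<in> Inv E S \<longleftrightarrow> a < b \<and> wbelow S b a \<and> \<not> wbelow S a b"
  using below_iff[OF hyp, of "\<Union>E" S b a] wb_dom[OF assms, of b a] assms unfolding Inv_def by auto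

lemma weak_Inv_iff:
  assumes "construct E S"
  shows "(a, b) \<in> weak_Inv E S \<longleftrightarrow> a < b \<and> wbelow S b a \<and> wbelow S a b"
  using same_node_iff[OF hyp, of "\<Union>E" S a b] wb_dom[OF assms, of b a] assms
  unfolding weak_Inv_def by auto

lemma inv_le_iff:
  assumes "construct E S" "construct E T"
  shows "inv_le S T \<longleftrightarrow> Inv E S \<subseteq> Inv E T \<and> weak_Inv E S \<subseteq> weak_Inv E T \<union> Inv E T"
  unfolding inv_le_def subset_iff Un_iff split_paired_All
    Inv_iff[OF assms(1)] Inv_iff[OF assms(2)] weak_Inv_iff[OF assms(1)] weak_Inv_iff[OF assms(2)]
  by blast

text \<open>The elements \<open>> x\<close> weakly below \<open>w\<close>, together with \<open>x\<close>, form a connected set, whose greatest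
  element compares both \<open>x\<close> and \<open>w\<close>.\<close>

lemma wb_comparable:
  assumes T: "construct E T" and "w < x" "x < u" "wbelow T u w" "x \<in> vertices E"
  shows "wbelow T x w \<or> wbelow T w x"
proof -
  let ?G = "{b. wbelow T b w}"
  let ?K = "insert x {d\<in>?G. x < d}"
  have w: "w \<in> vertices E" using wb_dom(1)[OF T assms(4)] .
  have "conn E ?K"
    using right_filled_conn[OF hyp rf down_conn[OF T w], of w x] wb_refl[OF T w] assms by simp
  moreover have "?K \<subseteq> vertices E" using wb_dom(2)[OF T] assms(5) by blast
  ultimately obtain q where q: "q \<in> ?K" "\<And>b. b \<in> ?K \<Longrightarrow> wbelow T b q"
    using top_ex[OF T, of ?K] by blast
  show ?thesis
  proof (cases "q = x")
    case True
    then have "wbelow T u x" using q(2)[of u] assms by simp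
    then show ?thesis using wb_forest[OF T assms(4)] by blast
  next
    case False
    then have "wbelow T q w" "wbelow T x q" using q by auto
    then show ?thesis using wb_trans[OF T] by blast
  qed
qed

section \<open>Flips respect the inversion condition\<close>

lemma contracts_same:
  assumes "contracts S U V S'" "construct E S" "x \<in> U \<and> y \<in> U \<or> x \<in> V \<and> y \<in> V"
  shows "wbelow S x y"
  using contracts_nodes[OF assms(1)] wb_node[OF assms(2), of _ x] assms(3) by blast

lemma nodes_finite:
  assumes "construct E S" "A \<in> nodes S"
  shows "finite A" "A \<noteq> {}"
proof -
  have "A \<subseteq> vertices E"
    using supp_construct[OF assms(1) hyp] assms(2) unfolding supp_def by blast
  then show "finite A" using hyp unfolding hypergraph_def by (meson finite_subset)
  show "A \<noteq> {}" using nodes_nonempty[OF hyp, of "\<Union>E" S A] assms by simp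
qed

lemma contracts_set_less:
  assumes "contracts S U V S'" "construct E S"
  shows "set_less V U \<longleftrightarrow> (\<forall>v\<in>V. \<forall>u\<in>U. v < u)"
    and "set_less U V \<longleftrightarrow> (\<forall>u\<in>U. \<forall>v\<in>V. u < v)" and "\<exists>u. u \<in> U" "\<exists>v. v \<in> V"
proof -
  have UV: "finite U" "finite V" "U \<noteq> {}" "V \<noteq> {}"
    using contracts_nodes[OF assms(1)] nodes_finite[OF assms(2)] by blast+
  show "set_less V U \<longleftrightarrow> (\<forall>v\<in>V. \<forall>u\<in>U. v < u)" "set_less U V \<longleftrightarrow> (\<forall>u\<in>U. \<forall>v\<in>V. u < v)"
    by (rule set_less_iff; fact UV)+
  show "\<exists>u. u \<in> U" "\<exists>v. v \<in> V" using UV(3,4) by blast+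
qed

text \<open>Fusion only adds relations, so just strictness can fail. If \<open>a\<close> became
  weakly below \<open>b\<close> in \<open>V\<close>, it would lie between \<open>V\<close> and
  \<open>U\<close>: membership in \<open>V\<close> makes the pair non-strict already, membership in
  \<open>U\<close> contradicts \<open>a < b\<close>.\<close>

lemma fusion_inv_le:
  assumes c: "contracts S U V S'" and S: "construct E S"
    and less: "\<And>v u. v \<in> V \<Longrightarrow> u \<in> U \<Longrightarrow> v < u"
  shows "inv_le S S'"
  unfolding inv_le_def
proof (intro allI impI conjI)
  fix a b assume ab: "a < b" "wbelow S b a"
  show "wbelow S' b a" using wb_contracts[OF c S] ab by blast
  assume nab: "\<not> wbelow S a b"
  show "\<not> wbelow S' a b"
  proof
    assume "wbelow S' a b"
    then obtain u where u: "b \<in> V" "u \<in> U" "wbelow S a u"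
      using wb_contracts[OF c S] nab by blast
    then have "a \<in> U \<union> V" using wb_cover[OF c S u(2,1)] ab(2) by blast
    then show False using contracts_same[OF c S, of a b] nab less[OF u(1)] u(1) ab(1) by fastforce
  qed
qed

text \<open>Splitting only deletes relations; the danger is \<open>b\<close> below \<open>a\<close>
  in \<open>U\<close> being lost because \<open>b\<close> hangs elsewhere below \<open>V\<close>.
  The elements above \<open>a\<close> in value and below \<open>v\<close> in the tree, together with
  \<open>a\<close>, are connected, and their greatest element is forced into \<open>U\<close>, so
  \<open>b\<close> remains below \<open>a\<close>.\<close>

lemma split_inv_le:
  assumes c: "contracts S' V U S" and S': "construct E S'"
    and less: "\<And>v u. v \<in> V \<Longrightarrow> u \<in> U \<Longrightarrow> v < u"
  shows "inv_le S S'"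
  unfolding inv_le_def
proof (intro allI impI conjI)
  fix a b assume ab: "a < b" "wbelow S b a"
  show "wbelow S' b a"
  proof (rule ccontr)
    assume n: "\<not> wbelow S' b a"
    then obtain v where v: "a \<in> U" "v \<in> V" "wbelow S' b v"
      using wb_contracts[OF c S'] ab by blast
    have av: "wbelow S' a v" using wb_cover[OF c S' v(2,1)] by blast
    have a: "a \<in> vertices E" and vE: "v \<in> vertices E" using wb_dom[OF S' av] by auto
    let ?D = "{x. wbelow S' x v}"
    let ?K = "insert a {d\<in>?D. a < d}"
    have "conn E ?K"
      using right_filled_conn[OF hyp rf down_conn[OF S' vE], of a a] a av by simp
    moreover have "?K \<subseteq> vertices E" using wb_dom(2)[OF S'] a by blast
    ultimately obtain p where p: "p \<in> ?K" "\<And>b. b \<in> ?K \<Longrightarrow> wbelow S' b p"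
      using top_ex[OF S', of ?K] by blast
    have "wbelow S' p v" "wbelow S' a p" using p av by auto
    then have "p \<in> V \<union> U" using wb_cover[OF c S' v(2,1)] by blast
    moreover have "a \<le> p" using p(1) by auto
    then have "p \<notin> V" using less[of p a] v(1) by auto
    ultimately have "wbelow S' p a" using contracts_same[OF c S', of p a] v(1) by blast
    moreover have "wbelow S' b p" using p(2) ab(1) v(3) by blast
    ultimately show False using n wb_trans[OF S'] by blast
  qed
  assume "\<not> wbelow S a b"
  then show "\<not> wbelow S' a b" using wb_contracts[OF c S'] by blast
qed

lemma inversion_code_subset: "construct E S \<Longrightarrow> inversion_code S \<subseteq> vertices E \<times> vertices E <+> vertices E \<times> vertices E"
  using wb_dom unfolding inversion_code_def by blast

text \<open>For \<open>v\<close> in \<open>V\<close> and \<open>u\<close> in \<open>U\<close>, a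
  fusion makes \<open>(v, u)\<close> a new weak relation (left summand) and a split makes it newly
  strict (right summand).\<close>

lemma flip_inv_le:
  assumes "flip E S S'"
  shows "inv_le S S'" "inversion_code S \<subset> inversion_code S'"
proof -
  have S: "construct E S" "construct E S'" using assms by (auto simp: flip_def)
  have "inv_le S S' \<and> inversion_code S \<noteq> inversion_code S'"
  proof -
    obtain U V where UV: "set_less V U" "contracts S U V S' \<or> contracts S' V U S"
      using assms unfolding flip_def by blast
    from UV(2) show ?thesis
    proof
      assume c: "contracts S U V S'"
      have less: "\<And>v u. v \<in> V \<Longrightarrow> u \<in> U \<Longrightarrow> v < u"
        using contracts_set_less(1)[OF c S(1)] UV(1) by blast
      obtain u v where uv: "u \<in> U" "v \<in> V" using contracts_set_less(3,4)[OF c S(1)] by blast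
      have "\<not> wbelow S u v" "wbelow S' u v"
        using wb_cover[OF c S(1) uv] wb_contracts[OF c S(1)] contracts_same[OF c S(1), of u u] uv
        by blast+
      then have "Inl (v, u) \<in> inversion_code S' - inversion_code S" using less uv by (auto simp: inversion_code_def)
      then show ?thesis using fusion_inv_le[OF c S(1) less] by blast
    next
      assume c: "contracts S' V U S"
      have less: "\<And>v u. v \<in> V \<Longrightarrow> u \<in> U \<Longrightarrow> v < u"
        using contracts_set_less(2)[OF c S(2)] UV(1) by blast
      obtain u v where uv: "u \<in> U" "v \<in> V" using contracts_set_less(3,4)[OF c S(2)] by blast
      have "\<not> wbelow S' v u" "wbelow S' u v" "wbelow S v u"
        using wb_cover[OF c S(2) uv(2,1)] wb_contracts[OF c S(2)]
          contracts_same[OF c S(2), of v v] uv by blast+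
      then have "Inr (v, u) \<in> inversion_code S' - inversion_code S" using less uv by (auto simp: inversion_code_def)
      then show ?thesis using split_inv_le[OF c S(2) less] by blast
    qed
  qed
  then show "inv_le S S'" "inversion_code S \<subset> inversion_code S'" using inv_le_inversion_code by blast+
qed

lemma flip_le_inv_le:
  assumes "flip_le E S T"
  shows "inv_le S T"
  using assms unfolding flip_le_def
proof (induction rule: rtranclp_induct)
  case base
  then show ?case by (simp add: inv_le_def)
next
  case (step T R)
  then show ?case using flip_inv_le(1) inv_le_trans by blast
qed

lemma split_step:
  assumes S: "construct E S" and T: "construct E T" and le: "inv_le S T"
    and ab: "a < b" "wbelow S a b" "wbelow S b a" "\<not> wbelow T a b"
  shows "\<exists>S'. flip E S S' \<and> inv_le S' T"
proof -
  define W where "W = {x. wbelow S a x \<and> wbelow S x a}"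
  \<comment> \<open>The cut prescribed by \<open>T\<close>: the elements of the node that are weakly
    above \<open>a\<close> in \<open>T\<close> form the upper part.\<close>
  define V where "V = {x\<in>W. wbelow T a x}"
  define U where "U = {x\<in>W. \<not> wbelow T a x}"
  have a: "a \<in> vertices E" using wb_dom(2)[OF S ab(2)] .
  then obtain A where "A \<in> nodes S" "a \<in> A"
    using supp_construct[OF S hyp] unfolding supp_def by blast
  then have "W \<in> nodes S" using wb_node[OF S] unfolding W_def by metis
  moreover have VU: "V \<union> U = W" by (auto simp: V_def U_def)
  ultimately have nd: "V \<union> U \<in> nodes S" by simp
  have mem: "a \<in> V" "b \<in> U"
    using wb_refl[OF S a] wb_refl[OF T a] ab by (auto simp: V_def U_def W_def)
  \<comment> \<open>If \<open>u < v\<close> inside one node of \<open>S\<close>, the condition puts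
    \<open>v\<close> weakly below \<open>u\<close> in \<open>T\<close>; then \<open>a\<close> is
    below \<open>u\<close> as well, so \<open>u\<close> would belong to \<open>V\<close>.\<close>
  have less: "v < u" if "v \<in> V" "u \<in> U" for v u
  proof (rule ccontr)
    assume "\<not> v < u"
    moreover have "v \<noteq> u" using that by (auto simp: V_def U_def)
    ultimately have "u < v" by simp
    moreover have "wbelow S v u"
      using that wb_trans[OF S] unfolding V_def U_def W_def by blast
    ultimately have "wbelow T v u" using inv_leD[OF le] by blast
    then show False using that wb_trans[OF T] unfolding V_def U_def by blast
  qed
  obtain S' where S': "construct E S'" "contracts S' V U S"
    using split_construct[OF hyp rf, of "\<Union>E" S V U] S conn_vertices nd mem less
    by auto
  have "flip E S S'"
    unfolding flip_def using S S' contracts_set_less(2)[OF S'(2,1)] less by blast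
  moreover have "inv_le S' T"
    unfolding inv_le_def
  proof (intro allI impI conjI)
    fix x y assume xy: "x < y" "wbelow S' y x"
    have yx: "wbelow S y x" using xy(2) wb_contracts[OF S'(2,1)] by blast
    then show "wbelow T y x" using inv_leD(1)[OF le xy(1)] by blast
    assume n: "\<not> wbelow S' x y"
    show "\<not> wbelow T x y"
    proof (cases "wbelow S x y")
      case False
      then show ?thesis using inv_leD(2)[OF le xy(1) yx] by blast
    next
      case True
      \<comment> \<open>A pair that only now becomes strict has \<open>y\<close> in \<open>U\<close>
        and \<open>x\<close> in \<open>V\<close>, and these are separated in \<open>T\<close> by
        being above \<open>a\<close> or not.\<close>
      then have y: "y \<in> U" using n wb_contracts[OF S'(2,1)] by blast
      then have "x \<in> W" using True yx wb_trans[OF S] unfolding U_def W_def by blast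
      moreover have "x \<notin> U" using contracts_same[OF S'(2,1), of x y] n y by blast
      ultimately have "wbelow T a x" by (simp add: U_def)
      moreover have "\<not> wbelow T a y" using y by (simp add: U_def)
      ultimately show ?thesis using wb_trans[OF T] by blast
    qed
  qed
  ultimately show ?thesis by blast
qed

lemma fusion_step:
  assumes S: "construct E S" and T: "construct E T" and le: "inv_le S T"
    and coarse: "\<And>a b. wbelow S a b \<Longrightarrow> wbelow S b a \<Longrightarrow> wbelow T a b"
    and ne: "S \<noteq> T"
  shows "\<exists>S'. flip E S S' \<and> inv_le S' T"
proof -
  note trS = wb_trans[OF S] and trT = wb_trans[OF T]
  have fin: "finite (vertices E)" using hyp by (simp add: hypergraph_def)
  define bad where "bad w u \<longleftrightarrow> w < u \<and> wbelow S w u \<and> \<not> wbelow S u w \<and> wbelow T u w" for w u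
  have "\<exists>w u. bad w u"
  proof (rule ccontr)
    assume nobad: "\<nexists>w u. bad w u"
    \<comment> \<open>Without bad pairs, the \<open>T\<close>-greatest element \<open>q\<close> of
      the \<open>S\<close>-down-set of \<open>a\<close> is equivalent to \<open>a\<close> in
      \<open>S\<close>: \<open>q < a\<close> would be a bad pair, and \<open>a < q\<close> violates
      preservation of strict inversions. Then \<open>coarse\<close> transfers the equivalence to
      \<open>T\<close>.\<close>
    have ST: "wbelow T b a" if ba: "wbelow S b a" for a b
    proof -
      let ?K = "{b. wbelow S b a}"
      have a: "a \<in> vertices E" using wb_dom(1)[OF S ba] .
      have "conn E ?K" "?K \<subseteq> vertices E" "a \<in> ?K"
        using down_conn[OF S a] wb_dom(2)[OF S] wb_refl[OF S a] by auto
      then obtain q where q: "q \<in> ?K" "\<And>k. k \<in> ?K \<Longrightarrow> wbelow T k q"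
        using top_ex[OF T, of ?K] by blast
      have aq: "wbelow T a q" using q(2)[OF \<open>a \<in> ?K\<close>] .
      have "wbelow S a q"
      proof (rule ccontr)
        assume n: "\<not> wbelow S a q"
        then have "q \<noteq> a" using \<open>a \<in> ?K\<close> by auto
        moreover have "\<not> q < a" using nobad n q(1) aq unfolding bad_def by blast
        ultimately have "a < q" by simp
        then show False using inv_leD(2)[OF le, of a q] q(1) n aq by blast
      qed
      then have "wbelow T q a" using coarse q(1) by blast
      then show ?thesis using q(2) ba trT by blast
    qed
    \<comment> \<open>The same argument with \<open>S\<close> and \<open>T\<close> exchanged; here
      \<open>a < q\<close> gives the bad pair.\<close>
    have TS: "wbelow S b a" if ba: "wbelow T b a" for a b
    proof -
      let ?K = "{b. wbelow T b a}"
      have a: "a \<in> vertices E" using wb_dom(1)[OF T ba] .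
      have "conn E ?K" "?K \<subseteq> vertices E" "a \<in> ?K"
        using down_conn[OF T a] wb_dom(2)[OF T] wb_refl[OF T a] by auto
      then obtain q where q: "q \<in> ?K" "\<And>k. k \<in> ?K \<Longrightarrow> wbelow S k q"
        using top_ex[OF S, of ?K] by blast
      have aq: "wbelow S a q" using q(2)[OF \<open>a \<in> ?K\<close>] .
      have qa: "wbelow T q a" using q(1) by simp
      have "wbelow S q a"
      proof (rule ccontr)
        assume n: "\<not> wbelow S q a"
        then have "q \<noteq> a" using aq by auto
        moreover have "\<not> a < q" using nobad n aq qa unfolding bad_def by blast
        ultimately have "q < a" by simp
        then show False using inv_leD(2)[OF le, of q a] aq n qa by blast
      qed
      then show ?thesis using q(2) ba trS by blast
    qed
    have "wbelow S = wbelow T" using ST TS by (intro ext) blast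
    then show False
      using construct_eqI[OF hyp, of "\<Union>E" S T] S T ne by simp
  qed
  then have "\<exists>u. \<exists>w. bad w u" by blast
  then obtain u where u: "\<exists>w. bad w u"
    and umin: "\<And>u'. \<exists>w. bad w u' \<Longrightarrow> card {x. wbelow S x u} \<le> card {x. wbelow S x u'}"
    using ex_has_least_nat[of "\<lambda>u. \<exists>w. bad w u" _ "\<lambda>u. card {x. wbelow S x u}"] by blast
  have finS: "finite {x. wbelow S x y}" and finT: "finite {x. wbelow T x y}" for y
    using wb_dom(2)[OF S] wb_dom(2)[OF T] fin by (metis (no_types, lifting) finite_subset mem_Collect_eq subsetI)+
  \<comment> \<open>Strictly smaller down-sets have strictly smaller cardinality, so the minimality
    of \<open>u\<close> excludes bad pairs further down.\<close>
  have nobelow: "\<not> bad w x" if x: "wbelow S x u" "\<not> wbelow S u x" for w x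
  proof
    assume "bad w x"
    then have le: "card {y. wbelow S y u} \<le> card {y. wbelow S y x}" using umin by blast
    have "u \<in> {y. wbelow S y u}" using wb_refl[OF S] wb_dom(1)[OF S x(1)] by blast
    then have "{y. wbelow S y x} \<subset> {y. wbelow S y u}" using x trS by blast
    then show False using psubset_card_mono[OF finS[of u]] le by (meson leD)
  qed
  \<comment> \<open>The size of the \<open>T\<close>-down-set measures height in \<open>T\<close>.
    Maximal height yields \<open>vmax1\<close>; taking the largest \<open>v\<close> of that height
    yields \<open>vmax2\<close>.\<close>
  let ?h = "\<lambda>w. card {x. wbelow T x w}"
  have finB: "finite {w. bad w u}"
    using finS[of u] by (rule finite_subset[rotated]) (auto simp: bad_def)
  define m where "m = Max (?h ` {w. bad w u})"
  define v where "v = Max {w. bad w u \<and> ?h w = m}"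
  have "m \<in> ?h ` {w. bad w u}" unfolding m_def using finB u by (intro Max_in) auto
  then have ne': "{w. bad w u \<and> ?h w = m} \<noteq> {}" by auto
  have finM: "finite {w. bad w u \<and> ?h w = m}" using finB by (rule rev_finite_subset) auto
  have v: "bad v u" "?h v = m" using Max_in[OF finM ne'] by (auto simp: v_def)
  have vmax1: "wbelow T w v" if w: "bad w u" "wbelow T v w" for w
  proof (rule ccontr)
    assume n: "\<not> wbelow T w v"
    have "w \<in> {x. wbelow T x w}" using wb_refl[OF T] wb_dom(1)[OF T w(2)] by blast
    then have "{x. wbelow T x v} \<subset> {x. wbelow T x w}" using n w(2) trT by blast
    then have "?h v < ?h w" using finT by (simp add: psubset_card_mono)
    moreover have "?h w \<le> m" unfolding m_def using finB w(1) by (intro Max_ge) auto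
    ultimately show False using v(2) by simp
  qed
  have vmax2: "w \<le> v" if w: "bad w u" "wbelow T v w" for w
  proof -
    have "{x. wbelow T x v} = {x. wbelow T x w}" using w vmax1[OF w] trT by blast
    then have "?h w = m" using v(2) by simp
    then show ?thesis unfolding v_def using finM w(1) by (intro Max_ge) auto
  qed
  have vu: "v < u" "wbelow S v u" "\<not> wbelow S u v" "wbelow T u v" using v(1) by (auto simp: bad_def)
  \<comment> \<open>An \<open>x\<close> strictly between \<open>v\<close> and \<open>u\<close> in
    \<open>S\<close> turns out to be strictly above \<open>v\<close> in \<open>T\<close> and bad
    with \<open>u\<close>, against \<open>vmax1\<close>.\<close>
  have child: "wbelow S x v \<or> wbelow S u x" if x: "wbelow S v x" "wbelow S x u" for x
  proof (rule ccontr)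
    assume "\<not> ?thesis"
    then have n: "\<not> wbelow S x v" "\<not> wbelow S u x" by auto
    have xE: "x \<in> vertices E" using wb_dom[OF S x(1)] by blast
    have "x \<noteq> v" "x \<noteq> u" using n x by auto
    have vx: "wbelow T v x \<and> \<not> wbelow T x v"
    proof (cases "x < v")
      case True
      then show ?thesis using inv_leD[OF le True x(1)] n(1) by blast
    next
      case False
      then have "v < x" using \<open>x \<noteq> v\<close> by simp
      then have 1: "\<not> wbelow T x v" using nobelow[OF x(2) n(2), of v] x n unfolding bad_def by blast
      moreover have "x < u"
      proof (rule ccontr)
        assume "\<not> x < u"
        then have "u < x" using \<open>x \<noteq> u\<close> by simp
        then have "wbelow T x u" using inv_leD(1)[OF le _ x(2)] by blast
        then show False using 1 vu(4) trT by blast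
      qed
      \<comment> \<open>Since \<open>v < x < u\<close>, right-filledness forces comparability in
        \<open>T\<close>, and one direction is already excluded.\<close>
      then have "wbelow T x v \<or> wbelow T v x"
        using wb_comparable[OF T \<open>v < x\<close> _ vu(4) xE] by blast
      ultimately show ?thesis by blast
    qed
    then have ux: "wbelow T u x" using vu(4) trT by blast
    have "x < u"
    proof (rule ccontr)
      assume "\<not> x < u"
      then have "u < x" using \<open>x \<noteq> u\<close> by simp
      then show False using inv_leD(2)[OF le _ x(2) n(2)] ux by blast
    qed
    then have "bad x u" using x n ux by (simp add: bad_def)
    then show False using vmax1 vx by blast
  qed
  define U where "U = {x. wbelow S u x \<and> wbelow S x u}"
  define V where "V = {x. wbelow S v x \<and> wbelow S x v}"
  obtain S' where c: "contracts S U V S'"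
    using cover_contracts[OF hyp, of "\<Union>E" S v u] S vu(2,3) child unfolding U_def V_def by auto
  have S': "construct E S'"
    using contracts_construct[OF hyp c, of "\<Union>E"] S by simp
  have uU: "wbelow S x u" "wbelow S u x" "wbelow T x u" "wbelow T u x" if "x \<in> U" for x
    using that coarse by (auto simp: U_def)
  have vV: "wbelow S x v" "wbelow S v x" "wbelow T x v" "wbelow T v x" if "x \<in> V" for x
    using that coarse by (auto simp: V_def)
  \<comment> \<open>With \<open>b < a\<close> the pair would be a strict inversion of
    \<open>S\<close>, hence of \<open>T\<close>, but in \<open>T\<close> the class of
    \<open>u\<close> is weakly below that of \<open>v\<close>.\<close>
  have less: "a < b" if "a \<in> V" "b \<in> U" for a b
  proof (rule ccontr)
    assume n: "\<not> a < b"
    have ab: "wbelow S a b" "\<not> wbelow S b a" using wb_cover[OF c S that(2,1)] by auto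
    then have "b \<noteq> a" by auto
    then have "b < a" using n by simp
    then have "\<not> wbelow T b a" using inv_leD(2)[OF le _ ab] by blast
    moreover have "wbelow T b a" using uU(3)[OF that(2)] vV(4)[OF that(1)] vu(4) trT by blast
    ultimately show False by blast
  qed
  have uinU: "u \<in> U" using wb_refl[OF S wb_dom(1)[OF S vu(2)]] by (simp add: U_def)
  \<comment> \<open>Covers the relations created by fusion between \<open>V\<close> and elements
    strictly below \<open>U\<close>: \<open>T\<close> must already have them strictly.\<close>
  have key: "wbelow T b a \<and> \<not> wbelow T a b"
    if a: "a \<in> V" and ab: "a < b" and b: "wbelow S b u" "\<not> wbelow S u b" "\<not> wbelow S b a" for a b
  proof -
    have bE: "b \<in> vertices E" using wb_dom(2)[OF S b(1)] .
    have ua: "wbelow T u a" using vu(4) vV(4)[OF a] trT by blast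
    have "b \<noteq> u" using b by auto
    show ?thesis
    proof (cases "u < b")
      case True
      then have "wbelow T b u" "\<not> wbelow T u b" using inv_leD[OF le True b(1)] b(2) by auto
      then show ?thesis using ua trT by blast
    next
      case False
      then have bu: "b < u" using \<open>b \<noteq> u\<close> by simp
      have "\<not> wbelow T a b"
      proof
        assume 1: "wbelow T a b"
        then have "bad b u" using bu b ua trT unfolding bad_def by blast
        moreover have "wbelow T v b" using vV(4)[OF a] 1 trT by blast
        \<comment> \<open>This is where the tie-break by the largest \<open>v\<close> enters. From
          \<open>a < b < v\<close> with \<open>a\<close> and \<open>v\<close> in one node,
          comparability is now applied in \<open>S\<close>; it places \<open>b\<close> between
          \<open>v\<close> and \<open>u\<close>, so \<open>child\<close> forces \<open>b\<close>
          into the node of \<open>v\<close>.\<close>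
        ultimately have "b \<le> v" using vmax2 by blast
        moreover have "b \<noteq> v" using b(3) vV(2)[OF a] by auto
        ultimately have "b < v" by simp
        then have "wbelow S b a \<or> wbelow S a b"
          using wb_comparable[OF S ab _ vV(2)[OF a] bE] by blast
        then have "wbelow S v b" using b(3) vV(2)[OF a] trS by blast
        then have "wbelow S b v" using child b(1,2) by blast
        then show False using vV(2)[OF a] b(3) trS by blast
      qed
      moreover have "wbelow T b a \<or> wbelow T a b"
        using wb_comparable[OF T ab bu ua bE] .
      ultimately show ?thesis by blast
    qed
  qed
  have "flip E S S'"
    unfolding flip_def using S S' c contracts_set_less(1)[OF c S] less by blast
  moreover have "inv_le S' T"
    unfolding inv_le_def
  proof (intro allI impI)
    fix x y assume xy: "x < y" "wbelow S' y x"
    show "wbelow T y x \<and> (\<not> wbelow S' x y \<longrightarrow> \<not> wbelow T x y)"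
    proof (cases "wbelow S y x")
      case True
      then show ?thesis using inv_leD[OF le xy(1) True] wb_contracts[OF c S, of x y] by blast
    next
      case False
      then obtain u' where u': "x \<in> V" "u' \<in> U" "wbelow S y u'"
        using xy(2) wb_contracts[OF c S] by blast
      then have yu: "wbelow S y u" using uU(1) trS by blast
      show ?thesis
      proof (cases "wbelow S u y")
        case True
        then have yU: "y \<in> U" using yu by (simp add: U_def)
        have "wbelow T y x" using uU(3)[OF yU] vV(4)[OF u'(1)] vu(4) trT by blast
        moreover have "wbelow S x y" using wb_cover[OF c S yU u'(1)] by blast
        then have "wbelow S' x y" using wb_contracts[OF c S] by blast
        ultimately show ?thesis by blast
      next
        case n: False
        show ?thesis using key[OF u'(1) xy(1) yu n False] by blast
      qed
    qed
  qed
  ultimately show ?thesis by blast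
qed

lemma inv_le_flip_le:
  assumes "construct E S" "construct E T" "inv_le S T"
  shows "flip_le E S T"
  using assms
proof (induction "card ((vertices E \<times> vertices E <+> vertices E \<times> vertices E) - inversion_code S)"
    arbitrary: S rule: less_induct)
  case (less S)
  show ?case
  proof (cases "S = T")
    case True
    then show ?thesis by (simp add: flip_le_def)
  next
    case False
    have "\<exists>S'. flip E S S' \<and> inv_le S' T"
    proof (cases "\<exists>a b. a < b \<and> wbelow S a b \<and> wbelow S b a \<and> \<not> wbelow T a b")
      case True
      then show ?thesis using split_step[OF less.prems] by blast
    next
      case n: False
      \<comment> \<open>Only \<open>a < b\<close> uses the failure of the split case; for
        \<open>b < a\<close> the inversion condition itself gives the claim.\<close>
      have "wbelow T a b" if ab: "wbelow S a b" "wbelow S b a" for a b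
      proof (cases a b rule: linorder_cases)
        case less
        then show ?thesis using n ab by blast
      next
        case equal
        then show ?thesis using wb_refl[OF less.prems(2)] wb_dom(1)[OF less.prems(1) ab(1)] by simp
      next
        case greater
        then show ?thesis using inv_leD(1)[OF less.prems(3) _ ab(1)] by blast
      qed
      then show ?thesis using fusion_step[OF less.prems _ False] by blast
    qed
    then obtain S' where S': "flip E S S'" "inv_le S' T" by blast
    then have c: "construct E S'" by (simp add: flip_def)
    let ?N = "vertices E \<times> vertices E <+> vertices E \<times> vertices E"
    have "?N - inversion_code S' \<subset> ?N - inversion_code S"
      using flip_inv_le(2)[OF S'(1)] inversion_code_subset[OF c] by blast
    moreover have "finite (?N - inversion_code S)"
      using hyp unfolding hypergraph_def by (intro finite_Diff finite_Plus finite_cartesian_product) auto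
    ultimately have "card (?N - inversion_code S') < card (?N - inversion_code S)" by (simp add: psubset_card_mono)
    then have "flip_le E S' T" using less.hyps[OF _ c less.prems(2) S'(2)] by blast
    then show ?thesis using S'(1) unfolding flip_le_def by (rule converse_rtranclp_into_rtranclp[rotated])
  qed
qed

end

theorem theorem2p44:
  fixes E :: "'a::linorder set set" and S T :: "'a ctree"
  assumes "hypergraph E" and "hconnected E" and "right_filled E"
    and "construct E S" and "construct E T"
  shows "flip_le E S T \<longleftrightarrow>
    Inv E S \<subseteq> Inv E T \<and> weak_Inv E S \<subseteq> weak_Inv E T \<union> Inv E T"
proof -
  have "flip_le E S T \<longleftrightarrow> inv_le S T"
    using flip_le_inv_le[OF assms(1-3)] inv_le_flip_le[OF assms] by blast
  then show ?thesis using inv_le_iff[OF assms] by simp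
qed

end
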